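(* Let $T,S\in\mathcal{B}_n(\Omega)$ with $T=(M_z^*,\mathcal{H}_T,K_T)$ and $S=(M_z^*,\mathcal{H}_S,K_S)$, where $\mathcal{H}_T,\mathcal{H}_S$ are the analytic function spaces with reproducing kernels $K_T,K_S$ respectively. Then $T$ and $S$ are unitarily equivalent if and only if there exist a nonempty open subset $\Lambda$ of $\Omega^*$ and a holomorphic function $\Psi:\Lambda\to\mathcal{M}_n(\mathbb{C})$ with $\Psi(\mu)$ invertible for every $\mu\in\Lambda$ such that $$\frac{\partial}{\partial\lambda}\left[K_T(\lambda,\lambda)^{-1}\,\Psi(\lambda)^{-1}\,K_S(\lambda,\lambda)\right]=0\qquad\text{for all }\lambda\in\Lambda .$$
   Context: Let $\Omega\subset\mathbb{C}$ be open and connected, $n$ a positive integer, $\Omega^*=\{\lambda:\overline{\lambda}\in\Omega\}$, and let $\mathcal{M}_n(\mathbb{C})$ be the set of complex $n\times n$ matrices. For a complex separable Hilbert space $\mathcal{H}$, the Cowen-Douglas class $\mathcal{B}_n(\Omega)$ consists of bounded linear operators $T$ on $\mathcal{H}$ such that: (1) $\Omega\subset\sigma(T)$; (2) $\operatorname{ran}(T-\lambda)=\mathcal{H}$ for every $\lambda\in\Omega$; (3) the closed linear span of $\bigcup_{\lambda\in\Omega}\ker(T-\lambda)$ is $\mathcal{H}$; (4) $\dim\ker(T-\lambda)=n$ for every $\lambda\in\Omega$. The notation $T=(M_z^*,\mathcal{H},K)$ for $T\in\mathcal{B}_n(\Omega)$ means: $\mathcal{H}$ is a Hilbert space of holomorphic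 $\mathbb{C}^n$-valued functions on $\Omega^*$ with reproducing kernel $K:\Omega^*\times\Omega^*\to\mathcal{M}_n(\mathbb{C})$ (holomorphic in the first variable, anti-holomorphic in the second, $\langle f,K(\cdot,\lambda)\xi\rangle=\langle f(\lambda),\xi\rangle$ for $f\in\mathcal{H}$, $\xi\in\mathbb{C}^n$), $M_z$ is the bounded operator $(M_zf)(z)=zf(z)$ on $\mathcal{H}$, and $T=M_z^*$ is its adjoint. In this realization $\ker(T-\overline{\lambda})=\{K(\cdot,\lambda)\xi:\xi\in\mathbb{C}^n\}$ for $\lambda\in\Omega^*$, and $K(\lambda,\lambda)$ is positive definite, hence invertible. Operators $T$ and $S$ are unitarily equivalent, $T\sim_u S$, if $UT=SU$ for some unitary $U$ between the underlying Hilbert spaces. $\frac{\partial}{\partial\lambda}$ is the Wirtinger derivative, applied entrywise. *)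

theory Defs
  imports "HOL-Analysis.Analysis" "HOL-Library.Function_Algebras"
begin

section \<open>Complex vector spaces\<close>

class complex_vector = ab_group_add +
  fixes scaleC :: "complex \<Rightarrow> 'a \<Rightarrow> 'a"  (infixr "*\<^sub>C" 75)
  assumes scaleC_add_right: "a *\<^sub>C (x + y) = a *\<^sub>C x + a *\<^sub>C y"
    and scaleC_add_left: "(a + b) *\<^sub>C x = a *\<^sub>C x + b *\<^sub>C x"
    and scaleC_scaleC: "a *\<^sub>C (b *\<^sub>C x) = (a * b) *\<^sub>C x"
    and scaleC_one: "1 *\<^sub>C x = x"

global_interpretation cvs: vector_space "scaleC :: complex \<Rightarrow> 'a \<Rightarrow> 'a::complex_vector"
  by unfold_locales (rule scaleC_add_right scaleC_add_left scaleC_scaleC scaleC_one)+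

instantiation complex :: complex_vector
begin
definition scaleC_complex :: "complex \<Rightarrow> complex \<Rightarrow> complex"
  where "scaleC_complex a x = a * x"
instance
  by standard (simp_all add: scaleC_complex_def algebra_simps)
end

instantiation vec :: (complex_vector, finite) complex_vector
begin
definition scaleC_vec :: "complex \<Rightarrow> 'a ^ 'b \<Rightarrow> 'a ^ 'b"
  where "scaleC_vec a x = (\<chi> i. a *\<^sub>C (x $ i))"
instance
  by standard
    (simp_all add: scaleC_vec_def vec_eq_iff scaleC_add_right scaleC_add_left scaleC_scaleC scaleC_one)
end

instantiation "fun" :: (type, complex_vector) complex_vector
begin
definition scaleC_fun :: "complex \<Rightarrow> ('a \<Rightarrow> 'b) \<Rightarrow> 'a \<Rightarrow> 'b"
  where "scaleC_fun a f = (\<lambda>x. a *\<^sub>C f x)"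
instance
  by standard
    (simp_all add: scaleC_fun_def fun_eq_iff scaleC_add_right scaleC_add_left scaleC_scaleC scaleC_one)
end


section \<open>Complex Hilbert spaces and bounded operators\<close>

text \<open>
  A Hilbert space is given by a carrier \<open>H\<close>, a linear subspace of the ambient type, and an inner
  product \<open>ip\<close>, linear in the first and conjugate linear in the second argument; values of \<open>ip\<close>,
  and of operators on \<open>H\<close>, outside the carrier are irrelevant.
\<close>

definition hnorm :: "('a \<Rightarrow> 'a \<Rightarrow> complex) \<Rightarrow> 'a \<Rightarrow> real" where
  "hnorm ip x = sqrt (Re (ip x x))"

locale complex_hilbert_space =
  fixes H :: "'a::complex_vector set"
    and ip :: "'a \<Rightarrow> 'a \<Rightarrow> complex"
  assumes subspace_carrier: "cvs.subspace H"
    and ip_add_left: "\<lbrakk>x \<in> H; y \<in> H; z \<in> H\<rbrakk> \<Longrightarrow> ip (x + y) z = ip x z + ip y z"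
    and ip_scaleC_left: "\<lbrakk>x \<in> H; y \<in> H\<rbrakk> \<Longrightarrow> ip (a *\<^sub>C x) y = a * ip x y"
    and ip_cnj: "\<lbrakk>x \<in> H; y \<in> H\<rbrakk> \<Longrightarrow> ip y x = cnj (ip x y)"
    and ip_nonneg: "x \<in> H \<Longrightarrow> 0 \<le> Re (ip x x)"
    and ip_definite: "\<lbrakk>x \<in> H; ip x x = 0\<rbrakk> \<Longrightarrow> x = 0"
    and complete:
      "\<lbrakk>\<And>k. X k \<in> H; \<forall>e>0. \<exists>N. \<forall>j\<ge>N. \<forall>k\<ge>N. hnorm ip (X j - X k) < e\<rbrakk>
        \<Longrightarrow> \<exists>x\<in>H. (\<lambda>k. hnorm ip (X k - x)) \<longlonglongrightarrow> 0"

definition hclosure :: "'a::complex_vector set \<Rightarrow> ('a \<Rightarrow> 'a \<Rightarrow> complex) \<Rightarrow> 'a set \<Rightarrow> 'a set" where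
  "hclosure H ip A = {x \<in> H. \<forall>e>0. \<exists>y\<in>A. hnorm ip (x - y) < e}"

definition separable_hilbert :: "'a::complex_vector set \<Rightarrow> ('a \<Rightarrow> 'a \<Rightarrow> complex) \<Rightarrow> bool" where
  "separable_hilbert H ip \<longleftrightarrow> (\<exists>A\<subseteq>H. countable A \<and> hclosure H ip A = H)"

definition linear_map_on ::
  "'a::complex_vector set \<Rightarrow> 'b::complex_vector set \<Rightarrow> ('a \<Rightarrow> 'b) \<Rightarrow> bool" where
  "linear_map_on H H' T \<longleftrightarrow>
     (\<forall>x\<in>H. T x \<in> H') \<and>
     (\<forall>x\<in>H. \<forall>y\<in>H. T (x + y) = T x + T y) \<and>
     (\<forall>a. \<forall>x\<in>H. T (a *\<^sub>C x) = a *\<^sub>C T x)"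

definition bounded_operator ::
  "'a::complex_vector set \<Rightarrow> ('a \<Rightarrow> 'a \<Rightarrow> complex) \<Rightarrow> ('a \<Rightarrow> 'a) \<Rightarrow> bool" where
  "bounded_operator H ip T \<longleftrightarrow>
     linear_map_on H H T \<and> (\<exists>B. \<forall>x\<in>H. hnorm ip (T x) \<le> B * hnorm ip x)"

definition is_adjoint ::
  "'a::complex_vector set \<Rightarrow> ('a \<Rightarrow> 'a \<Rightarrow> complex) \<Rightarrow> ('a \<Rightarrow> 'a) \<Rightarrow> ('a \<Rightarrow> 'a) \<Rightarrow> bool" where
  "is_adjoint H ip M T \<longleftrightarrow>
     (\<forall>g\<in>H. T g \<in> H) \<and> (\<forall>f\<in>H. \<forall>g\<in>H. ip (M f) g = ip f (T g))"

definition op_spectrum ::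
  "'a::complex_vector set \<Rightarrow> ('a \<Rightarrow> 'a \<Rightarrow> complex) \<Rightarrow> ('a \<Rightarrow> 'a) \<Rightarrow> complex set" where
  "op_spectrum H ip T =
     {\<mu>. \<not> (\<exists>R. bounded_operator H ip R \<and>
              (\<forall>x\<in>H. R (T x - \<mu> *\<^sub>C x) = x \<and> T (R x) - \<mu> *\<^sub>C R x = x))}"

definition op_ker :: "'a::complex_vector set \<Rightarrow> ('a \<Rightarrow> 'a) \<Rightarrow> complex \<Rightarrow> 'a set" where
  "op_ker H T \<mu> = {x \<in> H. T x - \<mu> *\<^sub>C x = 0}"

text \<open>
  Note that \<^const>\<open>cvs.dim\<close> is \<open>0\<close> on infinite-dimensional spaces, so that the last conjunct does
  express finite dimension for \<open>n > 0\<close>.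
\<close>

definition cowen_douglas ::
  "nat \<Rightarrow> complex set \<Rightarrow> 'a::complex_vector set \<Rightarrow> ('a \<Rightarrow> 'a \<Rightarrow> complex) \<Rightarrow> ('a \<Rightarrow> 'a) \<Rightarrow> bool" where
  "cowen_douglas n \<Omega> H ip T \<longleftrightarrow>
     complex_hilbert_space H ip \<and> separable_hilbert H ip \<and> bounded_operator H ip T \<and>
     \<Omega> \<subseteq> op_spectrum H ip T \<and>
     (\<forall>\<mu>\<in>\<Omega>. (\<lambda>x. T x - \<mu> *\<^sub>C x) ` H = H) \<and>
     hclosure H ip (cvs.span (\<Union>\<mu>\<in>\<Omega>. op_ker H T \<mu>)) = H \<and>
     (\<forall>\<mu>\<in>\<Omega>. cvs.dim (op_ker H T \<mu>) = n)"

definition unitary_map ::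
  "'a::complex_vector set \<Rightarrow> ('a \<Rightarrow> 'a \<Rightarrow> complex) \<Rightarrow>
   'b::complex_vector set \<Rightarrow> ('b \<Rightarrow> 'b \<Rightarrow> complex) \<Rightarrow> ('a \<Rightarrow> 'b) \<Rightarrow> bool" where
  "unitary_map H ip H' ip' U \<longleftrightarrow>
     linear_map_on H H' U \<and> bij_betw U H H' \<and> (\<forall>x\<in>H. \<forall>y\<in>H. ip' (U x) (U y) = ip x y)"

definition unitarily_equivalent ::
  "'a::complex_vector set \<Rightarrow> ('a \<Rightarrow> 'a \<Rightarrow> complex) \<Rightarrow> ('a \<Rightarrow> 'a) \<Rightarrow>
   'b::complex_vector set \<Rightarrow> ('b \<Rightarrow> 'b \<Rightarrow> complex) \<Rightarrow> ('b \<Rightarrow> 'b) \<Rightarrow> bool" where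
  "unitarily_equivalent H ip T H' ip' S \<longleftrightarrow>
     (\<exists>U. unitary_map H ip H' ip' U \<and> (\<forall>x\<in>H. U (T x) = S (U x)))"


section \<open>Analytic function spaces with reproducing kernel\<close>

definition conj_set :: "complex set \<Rightarrow> complex set" where
  "conj_set \<Omega> = {\<mu>. cnj \<mu> \<in> \<Omega>}"

definition cvec_inner :: "complex ^ 'n \<Rightarrow> complex ^ 'n \<Rightarrow> complex" where
  "cvec_inner x y = (\<Sum>i\<in>UNIV. x $ i * cnj (y $ i))"

definition vec_holomorphic_on :: "(complex \<Rightarrow> complex ^ 'n) \<Rightarrow> complex set \<Rightarrow> bool" where
  "vec_holomorphic_on f D \<longleftrightarrow> (\<forall>i. (\<lambda>z. f z $ i) holomorphic_on D)"

definition mat_holomorphic_on :: "(complex \<Rightarrow> complex ^ 'n ^ 'm) \<Rightarrow> complex set \<Rightarrow> bool" where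
  "mat_holomorphic_on F D \<longleftrightarrow> (\<forall>i j. (\<lambda>z. F z $ i $ j) holomorphic_on D)"

definition mat_antiholomorphic_on :: "(complex \<Rightarrow> complex ^ 'n ^ 'm) \<Rightarrow> complex set \<Rightarrow> bool" where
  "mat_antiholomorphic_on F D \<longleftrightarrow> (\<forall>i j. (\<lambda>z. cnj (F z $ i $ j)) holomorphic_on D)"

text \<open>
  Functions on a domain \<open>D\<close> are represented by total functions vanishing outside \<open>D\<close>; the value
  \<open>K z w\<close> of a kernel matters only for \<open>z, w \<in> D\<close>. The function \<open>K(\<cdot>, w) \<xi>\<close> on \<open>D\<close> thus becomes:
\<close>

definition kernel_section ::
  "complex set \<Rightarrow> (complex \<Rightarrow> complex \<Rightarrow> complex ^ 'n ^ 'n) \<Rightarrow> complex \<Rightarrow> complex ^ 'n \<Rightarrow>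
   complex \<Rightarrow> complex ^ 'n" where
  "kernel_section D K w \<xi> = (\<lambda>z. if z \<in> D then K z w *v \<xi> else 0)"

definition analytic_rkhs ::
  "complex set \<Rightarrow> (complex \<Rightarrow> complex ^ 'n) set \<Rightarrow>
   ((complex \<Rightarrow> complex ^ 'n) \<Rightarrow> (complex \<Rightarrow> complex ^ 'n) \<Rightarrow> complex) \<Rightarrow>
   (complex \<Rightarrow> complex \<Rightarrow> complex ^ 'n ^ 'n) \<Rightarrow> bool" where
  "analytic_rkhs D H ip K \<longleftrightarrow>
     complex_hilbert_space H ip \<and>
     (\<forall>f\<in>H. vec_holomorphic_on f D \<and> (\<forall>z. z \<notin> D \<longrightarrow> f z = 0)) \<and>
     (\<forall>w\<in>D. mat_holomorphic_on (\<lambda>z. K z w) D) \<and>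
     (\<forall>z\<in>D. mat_antiholomorphic_on (K z) D) \<and>
     (\<forall>w\<in>D. \<forall>\<xi>. kernel_section D K w \<xi> \<in> H \<and>
        (\<forall>f\<in>H. ip f (kernel_section D K w \<xi>) = cvec_inner (f w) \<xi>))"

definition mult_z :: "(complex \<Rightarrow> complex ^ 'n) \<Rightarrow> complex \<Rightarrow> complex ^ 'n" where
  "mult_z f = (\<lambda>z. z *\<^sub>C f z)"

text \<open>
  The relation \<open>T = (M\<^sub>z\<^sup>*, H, K)\<close> for \<open>T\<close> in the Cowen-Douglas class of rank \<open>n\<close> over \<open>\<Omega>\<close>.
  The description of the kernels in the last conjunct is part of what such a realization means: it
  is not automatic, since all functions in \<open>H\<close> could have a common zero. As the kernels have
  dimension \<open>n\<close>, it makes \<open>K w w\<close> positive definite.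
\<close>

definition cowen_douglas_model ::
  "complex set \<Rightarrow> (complex \<Rightarrow> complex ^ 'n) set \<Rightarrow>
   ((complex \<Rightarrow> complex ^ 'n) \<Rightarrow> (complex \<Rightarrow> complex ^ 'n) \<Rightarrow> complex) \<Rightarrow>
   (complex \<Rightarrow> complex \<Rightarrow> complex ^ 'n ^ 'n) \<Rightarrow>
   ((complex \<Rightarrow> complex ^ 'n) \<Rightarrow> complex \<Rightarrow> complex ^ 'n) \<Rightarrow> bool" where
  "cowen_douglas_model \<Omega> H ip K T \<longleftrightarrow>
     cowen_douglas CARD('n) \<Omega> H ip T \<and>
     analytic_rkhs (conj_set \<Omega>) H ip K \<and>
     bounded_operator H ip mult_z \<and>
     is_adjoint H ip mult_z T \<and>
     (\<forall>w\<in>conj_set \<Omega>. op_ker H T (cnj w) = range (kernel_section (conj_set \<Omega>) K w))"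


section \<open>Wirtinger derivative\<close>

definition wirtinger_deriv :: "(complex \<Rightarrow> complex) \<Rightarrow> complex \<Rightarrow> complex" where
  "wirtinger_deriv f z =
     (vector_derivative (\<lambda>t::real. f (z + of_real t)) (at 0)
      - \<i> * vector_derivative (\<lambda>t::real. f (z + \<i> * of_real t)) (at 0)) / 2"

definition mat_wirtinger_deriv ::
  "(complex \<Rightarrow> complex ^ 'n ^ 'm) \<Rightarrow> complex \<Rightarrow> complex ^ 'n ^ 'm" where
  "mat_wirtinger_deriv F z = (\<chi> i j. wirtinger_deriv (\<lambda>w. F w $ i $ j) z)"

end

theory Submission
  imports Defs
    "HOL-Complex_Analysis.Conformal_Mappings"
    "HOL-Computational_Algebra.Fundamental_Theorem_Algebra"
begin

text \<open>
The kernel sections \<open>K\<^sub>T(\<cdot>, w) \<xi>\<close> are the eigenvectors of \<open>T\<close> for the eigenvalue \<open>cnj w\<close>, and an operator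
in the Cowen-Douglas class is determined by the geometry of its eigenspaces over any nonempty open
set. Both directions therefore compare the two kernels; \<open>X\<^sup>*\<close> stands for the conjugate transpose.

If \<open>U\<close> is a unitary intertwiner, it maps \<open>K\<^sub>T(\<cdot>, w) \<xi>\<close> to \<open>K\<^sub>S(\<cdot>, w) A(w) \<xi>\<close>, and comparing inner products
gives \<open>K\<^sub>T(z, w) = A(z)\<^sup>* K\<^sub>S(z, w) A(w)\<close>. Freezing \<open>w = w\<^sub>0\<close> expresses \<open>A(z)\<^sup>*\<close> through functions that are
holomorphic in \<open>z\<close> near \<open>w\<^sub>0\<close>. With \<open>\<Psi> = (A\<^sup>*)\<^sup>-\<^sup>1\<close> the matrix in the theorem is just \<open>\<Psi>\<^sup>*\<close>, which is
antiholomorphic.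

Conversely, let \<open>K\<^sub>T(\<lambda>, \<lambda>)\<^sup>-\<^sup>1 \<Psi>(\<lambda>)\<^sup>-\<^sup>1 K\<^sub>S(\<lambda>, \<lambda>)\<close> have vanishing \<open>\<lambda>\<close>-derivative. Then it equals \<open>\<Phi>(\<lambda>)\<^sup>*\<close> with
\<open>\<Phi>\<close> holomorphic, so that \<open>\<Psi> K\<^sub>T \<Phi>\<^sup>* = K\<^sub>S\<close> on the diagonal, and by polarization
\<open>\<Psi>(z) K\<^sub>T(z, w) \<Phi>(w)\<^sup>* = K\<^sub>S(z, w)\<close> off the diagonal as well. Nothing forces \<open>\<Phi> = \<Psi>\<close>, and this is what has to be
repaired. Taking adjoints shows that \<open>C = \<Psi>\<^sup>-\<^sup>1 \<Phi>\<close> satisfies \<open>C(z) K\<^sub>T(z, w) = K\<^sub>T(z, w) C(w)\<^sup>*\<close>: it is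
self-adjoint for the inner products given by \<open>K\<^sub>T\<close>, and positive because \<open>K\<^sub>S\<close> is. So
\<open>M = C(c)\<^sup>*\<close> has a square root \<open>p(M)\<close> with \<open>p\<close> a real polynomial
(\<open>selfadjoint_positive_polynomial_sqrt\<close>). Since \<open>C(z)\<close> is similar to \<open>M\<close> through \<open>K\<^sub>T(z, c)\<close>, the same
polynomial gives \<open>p(C(z))\<^sup>2 = C(z)\<close> for all \<open>z\<close> near \<open>c\<close>, and being a real polynomial in \<open>C\<close>, \<open>p(C)\<close> inherits
the commutation rule of \<open>C\<close>. Hence \<open>G = \<Psi> p(C)\<close> satisfies \<open>K\<^sub>S(z, w) = G(z) K\<^sub>T(z, w) G(w)\<^sup>*\<close> near \<open>c\<close>
(\<open>kernel_factorization\<close>).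

Such a local factorization already yields a unitary operator: for each \<open>f\<close> in \<open>H\<^sub>T\<close> there is exactly one \<open>g\<close>
in \<open>H\<^sub>S\<close> with \<open>g = G f\<close> near \<open>c\<close>. This is clear for kernel sections at points near \<open>c\<close>; they span a dense
subspace by the identity theorem, and the map is isometric there (\<open>partner_exists\<close>). Pointwise multiplication
by \<open>G\<close> commutes with multiplication by \<open>z\<close>, so the unitary operator intertwines the adjoints \<open>T\<close> and \<open>S\<close>.

Two regularity questions remain. Polarization and the passage from a vanishing Wirtinger derivative to
antiholomorphy need the kernels to be jointly differentiable, whereas they are only known to be holomorphic or
antiholomorphic in each variable. This follows from Cauchy estimates once the kernels are bounded, and a Baire
category argument bounds them on some disc inside any given open set (\<open>kernel_bounded_on_ball\<close>). As the
conclusion is global, shrinking \<open>\<Lambda>\<close> to such a disc costs nothing.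
\<close>

section \<open>Bounded separately holomorphic functions of two variables\<close>

lemma norm_deriv_le_Cauchy:
  assumes "g holomorphic_on S" "cball z s \<subseteq> S" "0 < s" "\<And>x. x \<in> S \<Longrightarrow> norm (g x) \<le> M"
  shows "norm (deriv g z) \<le> M / s"
proof -
  have "norm ((deriv ^^ 1) g z) \<le> fact 1 * M / s ^ 1"
  proof (rule Cauchy_inequality)
    show "g holomorphic_on ball z s"
      using assms(1,2) by (meson ball_subset_cball holomorphic_on_subset)
    show "continuous_on (cball z s) g"
      using assms(1,2) by (meson holomorphic_on_imp_continuous_on holomorphic_on_subset)
    show "norm (g x) \<le> M" if "norm (z - x) = s" for x
    proof -
      have "x \<in> cball z s" using that by (simp add: dist_norm)
      then show ?thesis using assms by blast
    qed
  qed fact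
  then show ?thesis by simp
qed

text \<open>
Continuity of one partial derivative and existence of the other give total differentiability. Continuity of
the \<open>y\<close>-derivative is where boundedness enters: a Cauchy estimate makes \<open>f\<close> Lipschitz in \<open>x\<close> uniformly
in \<open>y\<close>, and a second one, applied to the difference \<open>f x' - f x\<close>, carries this over to the
\<open>y\<close>-derivative.
\<close>

proposition separately_holomorphic_has_derivative:
  fixes f :: "complex \<Rightarrow> complex \<Rightarrow> complex"
  assumes X: "open X" and Y: "open Y"
    and h1: "\<And>y. y \<in> Y \<Longrightarrow> (\<lambda>x. f x y) holomorphic_on X"
    and h2: "\<And>x. x \<in> X \<Longrightarrow> f x holomorphic_on Y"
    and bd: "\<And>x y. x \<in> X \<Longrightarrow> y \<in> Y \<Longrightarrow> norm (f x y) \<le> M"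
    and xy: "x \<in> X" "y \<in> Y"
  shows "\<exists>a b. ((\<lambda>(x, y). f x y) has_derivative (\<lambda>(h, k). a * h + b * k)) (at (x, y))"
proof -
  obtain r1 where r1: "r1 > 0" "cball x r1 \<subseteq> X" using X xy open_contains_cball by blast
  obtain r2 where r2: "r2 > 0" "cball y r2 \<subseteq> Y" using Y xy open_contains_cball by blast
  define r where "r = min r1 r2 / 2"
  have r: "r > 0" using r1 r2 by (simp add: r_def)
  have sub1: "cball x' r \<subseteq> X" if "x' \<in> ball x r" for x'
  proof -
    have "cball x' r \<subseteq> cball x r1"
    proof
      fix p assume "p \<in> cball x' r"
      then show "p \<in> cball x r1"
        using that dist_triangle[of x p x'] by (simp add: r_def)
    qed
    then show ?thesis using r1 by blast
  qed
  have sub2: "cball y' r \<subseteq> Y" if "y' \<in> ball y r" for y'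
  proof -
    have "cball y' r \<subseteq> cball y r2"
    proof
      fix p assume "p \<in> cball y' r"
      then show "p \<in> cball y r2"
        using that dist_triangle[of y p y'] by (simp add: r_def)
    qed
    then show ?thesis using r2 by blast
  qed
  have inX: "x' \<in> X" if "x' \<in> ball x r" for x'
    using sub1[OF that] r by force
  have inY: "y' \<in> Y" if "y' \<in> ball y r" for y'
    using sub2[OF that] r by force
  have M: "M \<ge> 0" using bd[OF xy] norm_ge_zero order_trans by blast
  have lip: "norm (f x' y' - f x y') \<le> M / r * norm (x' - x)"
    if x': "x' \<in> ball x r" and y': "y' \<in> Y" for x' y'
  proof (rule field_differentiable_bound[where S = "ball x r"])
    fix z assume z: "z \<in> ball x r"
    show "((\<lambda>x. f x y') has_field_derivative deriv (\<lambda>x. f x y') z) (at z within ball x r)"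
      using holomorphic_derivI[OF h1[OF y'] X] inX z by (meson has_field_derivative_at_within)
    show "norm (deriv (\<lambda>x. f x y') z) \<le> M / r"
      using norm_deriv_le_Cauchy[OF h1[OF y'] sub1[OF z] r] bd y' by blast
  qed (use x' r in auto)
  \<comment> \<open>The bound \<open>lip\<close> is uniform in \<open>y\<close>, so it may be differentiated by a Cauchy estimate.\<close>
  have der_diff: "norm (deriv (f x') y' - deriv (f x) y') \<le> M / r * norm (x' - x) / r"
    if x': "x' \<in> ball x r" and y': "y' \<in> ball y r" for x' y'
  proof -
    have d: "f x' field_differentiable at y'" "f x field_differentiable at y'"
      using h2 inX[OF x'] xy inY[OF y'] Y holomorphic_on_imp_differentiable_at by blast+
    have "norm (deriv (\<lambda>y. f x' y - f x y) y') \<le> M / r * norm (x' - x) / r"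
      by (rule norm_deriv_le_Cauchy[OF _ sub2[OF y'] r])
        (use h2 inX[OF x'] xy lip[OF x'] in \<open>auto intro: holomorphic_on_diff\<close>)
    then show ?thesis using d by simp
  qed
  have h2': "f x holomorphic_on Y" using h2 xy by blast
  have cont: "continuous_on (ball y r) (deriv (f x))"
    using holomorphic_deriv[OF h2' Y] inY
    by (meson holomorphic_on_imp_continuous_on holomorphic_on_subset subsetI)
  have lim: "((\<lambda>(x', y'). deriv (f x') y') \<longlongrightarrow> deriv (f x) y) (at (x, y) within ball x r \<times> ball y r)"
  proof -
    have 1: "((\<lambda>p. deriv (f x) (snd p)) \<longlongrightarrow> deriv (f x) y) (at (x, y) within ball x r \<times> ball y r)"
    proof -
      have "continuous_on (ball x r \<times> ball y r) (\<lambda>p. deriv (f x) (snd p))"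
        by (rule continuous_on_compose2[OF cont]) (auto intro: continuous_intros)
      then show ?thesis using r by (auto simp: continuous_on_def)
    qed
    have 2: "((\<lambda>p. deriv (f (fst p)) (snd p) - deriv (f x) (snd p)) \<longlongrightarrow> 0) (at (x, y) within ball x r \<times> ball y r)"
    proof (rule Lim_null_comparison)
      show "\<forall>\<^sub>F p in at (x, y) within ball x r \<times> ball y r.
          norm (deriv (f (fst p)) (snd p) - deriv (f x) (snd p)) \<le> M / r * norm (fst p - x) / r"
        unfolding eventually_at_filter by (rule always_eventually) (use der_diff in auto)
      show "((\<lambda>p. M / r * norm (fst p - x) / r) \<longlongrightarrow> 0) (at (x, y) within ball x r \<times> ball y r)"
        by (rule tendsto_eq_intros refl | use r in simp)+
    qed
    show ?thesis using tendsto_add[OF 2 1] by (simp add: case_prod_unfold)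
  qed
  define fy where "fy = (\<lambda>x' y'. blinfun_mult_right (deriv (f x') y'))"
  have "((\<lambda>(x, y). f x y) has_derivative (\<lambda>(tx, ty). deriv (\<lambda>x. f x y) x * tx + fy x y ty))
      (at (x, y) within ball x r \<times> ball y r)"
  proof (rule has_derivative_partialsI)
    show "((\<lambda>x. f x y) has_derivative (*) (deriv (\<lambda>x. f x y) x)) (at x within ball x r)"
      using holomorphic_derivI[OF h1[OF xy(2)] X xy(1)] has_field_derivative_def
      by (metis has_derivative_at_withinI)
    show "(f x' has_derivative blinfun_apply (fy x' y')) (at y' within ball y r)"
      if "x' \<in> ball x r" "y' \<in> ball y r" for x' y'
    proof -
      have "(f x' has_field_derivative deriv (f x') y') (at y')"
        using holomorphic_derivI[OF h2 Y] inX inY that by blast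
      moreover have "blinfun_apply (fy x' y') = (*) (deriv (f x') y')"
        by (auto simp: fy_def)
      ultimately show ?thesis
        by (simp add: has_field_derivative_def has_derivative_at_withinI)
    qed
    show "continuous (at (x, y) within ball x r \<times> ball y r) (\<lambda>(x, y). fy x y)"
      unfolding continuous_within
      using bounded_linear.tendsto[OF bounded_linear_blinfun_mult_right lim]
      by (simp add: fy_def case_prod_unfold)
    show "y \<in> ball y r" using r by simp
  qed simp
  moreover have "at (x, y) within ball x r \<times> ball y r = at (x, y)"
    by (rule at_within_open) (use r in \<open>auto intro: open_Times\<close>)
  ultimately have "((\<lambda>(x, y). f x y) has_derivative
      (\<lambda>(h, k). deriv (\<lambda>x. f x y) x * h + deriv (f x) y * k)) (at (x, y))"
    by (simp add: fy_def)
  then show ?thesis by blast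
qed

lemma holomorphic_cnj_cnj:
  assumes "(\<lambda>w. cnj (h w)) holomorphic_on D" "cnj ` E \<subseteq> D"  "open D"
  shows "(\<lambda>u. h (cnj u)) holomorphic_on E"
proof -
  have "(cnj \<circ> (\<lambda>w. cnj (h w)) \<circ> cnj) holomorphic_on (cnj ` D)"
  proof (rule holomorphic_on_compose_cnj_cnj)
    show "open (cnj ` D)"
      unfolding image_cnj_conv_vimage_cnj using assms by (intro open_vimage) auto
  qed (use assms in \<open>simp add: image_image\<close>)
  moreover have "E \<subseteq> cnj ` D" using assms(2) by (metis complex_cnj_cnj image_eqI image_subset_iff subsetI)
  ultimately show ?thesis by (auto simp: o_def intro: holomorphic_on_subset)
qed

text \<open>
Polarization. After centring at \<open>c\<close> and substituting \<open>u = cnj w\<close>, \<open>f\<close> is holomorphic in both variables and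
vanishes on \<open>u = cnj z\<close>. For \<open>\<bar>a\<bar> = 1\<close> the one-variable function \<open>t \<mapsto> f (a t) (cnj a t)\<close> is holomorphic by the
chain rule and vanishes for real \<open>t\<close>, hence for all \<open>t\<close>. The points \<open>(a t, cnj a t)\<close> are all the pairs of
equal modulus, so for fixed \<open>u \<noteq> 0\<close> the function \<open>f(\<cdot>, u)\<close> vanishes on a whole circle and therefore
everywhere.
\<close>

proposition sesquiholomorphic_diagonal_zero:
  fixes g :: "complex \<Rightarrow> complex \<Rightarrow> complex"
  assumes h1: "\<And>w. w \<in> ball c r \<Longrightarrow> (\<lambda>z. g z w) holomorphic_on ball c r"
    and h2: "\<And>z. z \<in> ball c r \<Longrightarrow> (\<lambda>w. cnj (g z w)) holomorphic_on ball c r"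
    and bd: "\<And>z w. z \<in> ball c r \<Longrightarrow> w \<in> ball c r \<Longrightarrow> norm (g z w) \<le> M"
    and diag: "\<And>w. w \<in> ball c r \<Longrightarrow> g w w = 0"
    and zw: "z \<in> ball c r" "w \<in> ball c r"
  shows "g z w = 0"
proof -
  define f where "f = (\<lambda>z u. g (c + z) (c + cnj u))"
  let ?B = "ball (0::complex) r"
  have r: "r > 0" using zw by (metis ball_empty empty_iff not_le)
  have sh: "c + z \<in> ball c r" if "z \<in> ?B" for z using that by (simp add: dist_norm)
  have f1: "(\<lambda>z. f z u) holomorphic_on ?B" if "u \<in> ?B" for u
  proof -
    have "(\<lambda>z. g z (c + cnj u)) \<circ> (\<lambda>z. c + z) holomorphic_on ?B"
      by (rule holomorphic_on_compose_gen[OF _ h1])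
        (use that sh in \<open>auto intro!: holomorphic_intros\<close>)
    then show ?thesis by (simp add: f_def o_def)
  qed
  have f2: "f z holomorphic_on ?B" if "z \<in> ?B" for z
  proof -
    have "(\<lambda>w. cnj (g (c + z) w)) \<circ> (\<lambda>w. c + w) holomorphic_on ?B"
      by (rule holomorphic_on_compose_gen[OF _ h2])
        (use that sh in \<open>auto intro!: holomorphic_intros\<close>)
    then have "(\<lambda>w. cnj (g (c + z) (c + w))) holomorphic_on ?B" by (simp add: o_def)
    then show ?thesis unfolding f_def by (rule holomorphic_cnj_cnj[where h = "\<lambda>w. g (c + z) (c + w)"]) auto
  qed
  have fb: "norm (f z u) \<le> M" if "z \<in> ?B" "u \<in> ?B" for z u
    unfolding f_def using that by (intro bd) (auto simp: dist_norm)
  have line: "f (a * t) (cnj a * t) = 0" if a: "norm a = 1" and t: "t \<in> ?B" for a t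
  proof (rule analytic_continuation[of "\<lambda>t. f (a * t) (cnj a * t)" ?B "of_real ` {0<..<r}" 0])
    show "(\<lambda>t. f (a * t) (cnj a * t)) holomorphic_on ?B"
    proof (rule holomorphic_onI)
      fix t assume t: "t \<in> ?B"
      then have in2: "a * t \<in> ?B" "cnj a * t \<in> ?B" using a by (auto simp: norm_mult)
      obtain A B where AB: "((\<lambda>(x, y). f x y) has_derivative (\<lambda>(h, k). A * h + B * k)) (at (a * t, cnj a * t))"
        using separately_holomorphic_has_derivative[OF open_ball open_ball f1 f2 fb in2] by blast
      have "((\<lambda>t. (a * t, cnj a * t)) has_derivative (\<lambda>h. (a * h, cnj a * h))) (at t)"
        by (auto intro!: derivative_eq_intros)
      from has_derivative_compose[OF this AB]
      have "((\<lambda>t. f (a * t) (cnj a * t)) has_derivative (\<lambda>h. A * (a * h) + B * (cnj a * h))) (at t)"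
        by simp
      moreover have "(\<lambda>h. A * (a * h) + B * (cnj a * h)) = (*) (A * a + B * cnj a)"
        by (auto simp: algebra_simps)
      ultimately have "((\<lambda>t. f (a * t) (cnj a * t)) has_field_derivative (A * a + B * cnj a)) (at t)"
        by (simp add: has_field_derivative_def)
      then show "(\<lambda>t. f (a * t) (cnj a * t)) field_differentiable at t within ?B"
        using field_differentiable_at_within field_differentiable_def by blast
    qed
    show "0 islimpt complex_of_real ` {0<..<r}"
    proof (subst islimpt_approachable, intro allI impI)
      fix e :: real assume e: "e > 0"
      define s where "s = min e r / 2"
      have "s \<in> {0<..<r}" "s < e" "s > 0" using e r by (auto simp: s_def)
      then show "\<exists>x'\<in>complex_of_real ` {0<..<r}. x' \<noteq> 0 \<and> dist x' 0 < e"
        by (intro bexI[of _ "of_real s"]) auto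
    qed
    show "f (a * t) (cnj a * t) = 0" if ts: "t \<in> complex_of_real ` {0<..<r}" for t
    proof -
      obtain s where s: "t = of_real s" "0 < s" "s < r" using ts by auto
      then show ?thesis unfolding f_def using a by (simp add: diag dist_norm norm_mult)
    qed
  qed (use r t in auto)
  have circ: "f z u = 0" if "norm z = norm u" "u \<noteq> 0" "u \<in> ?B" for z u
  proof -
    \<comment> \<open>The equations \<open>a t = z\<close>, \<open>cnj a t = u\<close> with \<open>\<bar>a\<bar> = 1\<close> multiply to \<open>t\<^sup>2 = z u\<close>.\<close>
    define t where "t = csqrt (z * u)"
    define a where "a = z / t"
    have tt: "t * t = z * u" by (simp add: t_def flip: power2_eq_square)
    have z0: "z \<noteq> 0" using that by auto
    have t0: "t \<noteq> 0" using tt z0 that by auto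
    have "(norm t)\<^sup>2 = (norm u)\<^sup>2" using tt that by (metis norm_mult power2_eq_square)
    then have nt: "norm t = norm u" by simp
    have na: "norm a = 1" using nt that by (simp add: a_def norm_divide)
    have "a * cnj a = 1" using na by (simp add: complex_norm_square[symmetric])
    then have "cnj a = t / z" using z0 t0 by (simp add: a_def field_simps)
    then have "z * (cnj a * t) = z * u" using tt z0 by simp
    then have "cnj a * t = u" using z0 by simp
    moreover have "a * t = z" using t0 by (simp add: a_def)
    moreover have "t \<in> ?B" using nt that by simp
    ultimately show ?thesis using line[OF na, of t] by simp
  qed
  have nz: "f z u = 0" if u: "u \<noteq> 0" "u \<in> ?B" and z: "z \<in> ?B" for z u
  proof (rule analytic_continuation[of "\<lambda>z. f z u" ?B "sphere 0 (norm u)" u])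
    have "u \<in> sphere 0 (norm u)" "- u \<in> sphere 0 (norm u)" "u \<noteq> - u" using u by auto
    then have "sphere 0 (norm u) \<noteq> {x}" for x :: complex by (metis singletonD)
    then show "u islimpt sphere 0 (norm u)"
      by (intro connected_imp_perfect) (auto simp: connected_sphere)
  qed (use u z f1 circ in auto)
  have "f z u = 0" if u: "u \<in> ?B" and z: "z \<in> ?B" for z u
  proof (rule analytic_continuation[of "f z" ?B "?B - {0}" 0])
    show "0 islimpt ?B - {0}"
      using r islimpt_punctured[of 0 ?B] by (simp add: islimpt_ball)
  qed (use u z f2 nz r in auto)
  from this[of "cnj (w - c)" "z - c"] zw show ?thesis
    by (simp add: f_def dist_norm norm_minus_commute flip: complex_cnj_diff)
qed

lemma sesquiholomorphic_diagonal_differentiable: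
  fixes g :: "complex \<Rightarrow> complex \<Rightarrow> complex"
  assumes h1: "\<And>w. w \<in> ball c r \<Longrightarrow> (\<lambda>z. g z w) holomorphic_on ball c r"
    and h2: "\<And>z. z \<in> ball c r \<Longrightarrow> (\<lambda>w. cnj (g z w)) holomorphic_on ball c r"
    and bd: "\<And>z w. z \<in> ball c r \<Longrightarrow> w \<in> ball c r \<Longrightarrow> norm (g z w) \<le> M"
    and w: "w \<in> ball c r"
  shows "(\<lambda>w. g w w) differentiable (at w)"
proof -
  define f where "f = (\<lambda>z u. g z (cnj u))"
  have cn: "cnj u \<in> ball c r" if "u \<in> ball (cnj c) r" for u
  proof -
    have "dist c (cnj u) = norm (cnj (cnj c - u))" by (simp add: dist_norm)
    also have "\<dots> = dist (cnj c) u" by (simp only: complex_mod_cnj dist_norm)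
    finally show ?thesis using that by simp
  qed
  have cw: "cnj w \<in> ball (cnj c) r"
  proof -
    have "dist (cnj c) (cnj w) = norm (cnj (c - w))" by (simp add: dist_norm)
    then show ?thesis using w by (simp only: complex_mod_cnj dist_norm mem_ball)
  qed
  have "\<exists>a b. ((\<lambda>(x, y). f x y) has_derivative (\<lambda>(h, k). a * h + b * k)) (at (w, cnj w))"
  proof (rule separately_holomorphic_has_derivative[of "ball c r" "ball (cnj c) r"])
    show "(\<lambda>x. f x y) holomorphic_on ball c r" if "y \<in> ball (cnj c) r" for y
      unfolding f_def using h1 cn that by blast
    show "f x holomorphic_on ball (cnj c) r" if "x \<in> ball c r" for x
      unfolding f_def by (rule holomorphic_cnj_cnj[OF h2[OF that]]) (use cn in auto)
    show "norm (f x y) \<le> M" if "x \<in> ball c r" "y \<in> ball (cnj c) r" for x y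
      unfolding f_def using bd cn that by blast
  qed (use w cw in auto)
  then obtain a b where ab: "((\<lambda>(x, y). f x y) has_derivative (\<lambda>(h, k). a * h + b * k)) (at (w, cnj w))"
    by blast
  have "((\<lambda>w. (w, cnj w)) has_derivative (\<lambda>h. (h, cnj h))) (at w)"
    by (auto intro!: derivative_eq_intros)
  from has_derivative_compose[OF this ab] show ?thesis
    unfolding differentiable_def f_def by auto
qed

section \<open>The Wirtinger derivative\<close>

text \<open>
The Wirtinger derivative only samples the two axis directions; for a totally differentiable function they
determine the real-linear derivative.
\<close>

lemma wirtinger_deriv_eq:
  assumes "(f has_derivative f') (at z)"
  shows "wirtinger_deriv f z = (f' 1 - \<i> * f' \<i>) / 2"
proof -
  have lin: "linear f'" using assms has_derivative_linear by blast
  have dir: "vector_derivative (\<lambda>t::real. f (z + v * of_real t)) (at 0) = f' v" for v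
  proof (rule vector_derivative_at)
    have "((\<lambda>t::real. z + v * of_real t) has_derivative (\<lambda>t. v * of_real t)) (at 0)"
      by (auto intro!: derivative_eq_intros)
    moreover have "(f has_derivative f') (at (z + v * of_real 0))" using assms by simp
    ultimately have "((\<lambda>t::real. f (z + v * of_real t)) has_derivative (\<lambda>t. f' (v * of_real t))) (at 0)"
      by (rule has_derivative_compose)
    moreover have "f' (v * of_real t) = t *\<^sub>R f' v" for t :: real
      using linear_scale[OF lin, of t v] by (simp add: scaleR_conv_of_real mult.commute)
    ultimately show "((\<lambda>t::real. f (z + v * of_real t)) has_vector_derivative f' v) (at 0)"
      by (simp add: has_vector_derivative_def)
  qed
  show ?thesis unfolding wirtinger_deriv_def using dir[of 1] dir[of \<i>] by simp
qed

text \<open>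
Total differentiability is essential: partial derivatives satisfying the Cauchy-Riemann equations at a point do
not suffice.
\<close>

lemma wirtinger_deriv_zero_imp_antiholomorphic:
  assumes "f differentiable (at z)" and 0: "wirtinger_deriv f z = 0"
  shows "(\<lambda>w. cnj (f w)) field_differentiable (at z)"
proof -
  obtain f' where f': "(f has_derivative f') (at z)" using assms unfolding differentiable_def by blast
  then have lin: "linear f'" using has_derivative_linear by blast
  have "f' 1 = \<i> * f' \<i>" using 0 wirtinger_deriv_eq[OF f'] by simp
  then have i: "f' \<i> = - \<i> * f' 1" by simp
  have "f' h = f' 1 * cnj h" for h
  proof -
    have "h = Re h *\<^sub>R 1 + Im h *\<^sub>R \<i>" by (simp add: complex_eq_iff)
    then have "f' h = Re h *\<^sub>R f' 1 + Im h *\<^sub>R f' \<i>"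
      by (metis linear_add[OF lin] linear_scale[OF lin])
    also have "\<dots> = f' 1 * cnj h" by (simp add: i complex_eq_iff)
    finally show ?thesis .
  qed
  then have "cnj (f' h) = cnj (f' 1) * h" for h
    by (metis complex_cnj_cnj complex_cnj_mult)
  then have "(\<lambda>h. cnj (f' h)) = (*) (cnj (f' 1))" by blast
  moreover have "((\<lambda>w. cnj (f w)) has_derivative (\<lambda>h. cnj (f' h))) (at z)"
    using f' by (rule has_derivative_cnj)
  ultimately have "((\<lambda>w. cnj (f w)) has_field_derivative cnj (f' 1)) (at z)"
    unfolding has_field_derivative_def by (simp only:)
  then show ?thesis unfolding field_differentiable_def by blast
qed

lemma wirtinger_deriv_antiholomorphic:
  assumes h: "h holomorphic_on \<Lambda>" and \<Lambda>: "open \<Lambda>" "z \<in> \<Lambda>" and f: "\<And>w. w \<in> \<Lambda> \<Longrightarrow> f w = cnj (h w)"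
  shows "wirtinger_deriv f z = 0"
proof -
  have "(h has_derivative (*) (deriv h z)) (at z)"
    using holomorphic_derivI[OF h \<Lambda>] by (simp add: has_field_derivative_def)
  then have "((\<lambda>w. cnj (h w)) has_derivative (\<lambda>d. cnj (deriv h z * d))) (at z)"
    by (rule has_derivative_cnj)
  then have "(f has_derivative (\<lambda>d. cnj (deriv h z * d))) (at z)"
    by (rule has_derivative_transform_within_open[OF _ \<Lambda>]) (simp add: f)
  from wirtinger_deriv_eq[OF this] show ?thesis by (simp add: complex_eq_iff)
qed

section \<open>Complex matrices\<close>

definition cadj :: "complex ^ 'n ^ 'm \<Rightarrow> complex ^ 'm ^ 'n" where
  "cadj A = (\<chi> i j. cnj (A $ j $ i))"

lemma cadj_nth [simp]: "cadj A $ i $ j = cnj (A $ j $ i)"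
  by (simp add: cadj_def)

lemma cadj_cadj [simp]: "cadj (cadj A) = A"
  by (simp add: vec_eq_iff)

lemma cadj_mult: "cadj (A ** B) = cadj B ** cadj A"
  by (simp add: vec_eq_iff matrix_matrix_mult_def mult.commute)

lemma cadj_add: "cadj (A + B) = cadj A + cadj B"
  by (simp add: vec_eq_iff)

lemma cadj_mat: "cadj (mat a) = mat (cnj a)"
  by (simp add: vec_eq_iff mat_def)

lemma cvec_inner_mult_left: "cvec_inner (A *v x) y = cvec_inner x (cadj A *v y)"
proof -
  have "cvec_inner (A *v x) y = (\<Sum>i\<in>UNIV. \<Sum>j\<in>UNIV. A $ i $ j * x $ j * cnj (y $ i))"
    by (simp add: cvec_inner_def matrix_vector_mult_def sum_distrib_right)
  also have "\<dots> = (\<Sum>j\<in>UNIV. \<Sum>i\<in>UNIV. A $ i $ j * x $ j * cnj (y $ i))"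
    by (rule sum.swap)
  also have "\<dots> = (\<Sum>j\<in>UNIV. \<Sum>i\<in>UNIV. x $ j * (A $ i $ j * cnj (y $ i)))"
    by (intro sum.cong refl) simp
  also have "\<dots> = cvec_inner x (cadj A *v y)"
    by (simp add: cvec_inner_def matrix_vector_mult_def sum_distrib_left)
  finally show ?thesis .
qed

lemma cvec_inner_mult_right: "cvec_inner x (A *v y) = cvec_inner (cadj A *v x) y"
  by (simp add: cvec_inner_mult_left)

lemma cvec_inner_axis [simp]: "cvec_inner x (axis i 1) = x $ i"
proof -
  have "cvec_inner x (axis i 1) = (\<Sum>k\<in>UNIV. if k = i then x $ k else 0)"
    unfolding cvec_inner_def by (rule sum.cong) (auto simp: axis_def)
  then show ?thesis by simp
qed

lemma cvec_inner_zero [simp]: "cvec_inner 0 y = 0" "cvec_inner x 0 = 0"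
  by (simp_all add: cvec_inner_def)

lemma cvec_inner_scale_left: "cvec_inner (a *s x) y = a * cvec_inner x y"
  by (simp add: cvec_inner_def sum_distrib_left mult.assoc)

lemma matrix_vector_axis [simp]: "((A::complex^'n^'m) *v axis j 1) $ i = A $ i $ j"
proof -
  have "(A *v axis j 1) $ i = (\<Sum>k\<in>UNIV. if k = j then A $ i $ k else 0)"
    unfolding matrix_vector_mult_def vec_lambda_beta axis_def by (rule sum.cong) auto
  then show ?thesis by simp
qed

lemma matrix_eq_vectorI: "(\<And>v. A *v v = B *v v) \<Longrightarrow> A = (B::complex^'n^'m)"
  by (simp add: matrix_eq)

lemma
  assumes "invertible (A::complex^'n^'n)"
  shows matrix_inv_right: "A ** matrix_inv A = mat 1"
    and matrix_inv_left: "matrix_inv A ** A = mat 1"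
proof -
  have "A ** matrix_inv A = mat 1 \<and> matrix_inv A ** A = mat 1"
    using assms unfolding matrix_inv_def invertible_def by (rule someI_ex)
  then show "A ** matrix_inv A = mat 1" "matrix_inv A ** A = mat 1" by blast+
qed

lemma invertibleI: "A ** B = mat 1 \<Longrightarrow> invertible (A::complex^'n^'n)"
  unfolding invertible_def using matrix_left_right_inverse[of A B] by blast

lemma matrix_inv_unique:
  assumes "A ** B = mat 1" shows "matrix_inv (A::complex^'n^'n) = B"
proof -
  have "matrix_inv A ** A = mat 1" by (rule matrix_inv_left[OF invertibleI[OF assms]])
  then have "B = matrix_inv A ** (A ** B)" by (simp only: matrix_mul_assoc matrix_mul_lid)
  then show ?thesis using assms by simp
qed

lemma invertible_matrix_inv: "invertible A \<Longrightarrow> invertible (matrix_inv (A::complex^'n^'n))"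
  by (rule invertibleI[OF matrix_inv_left])

lemma invertible_cadj:
  assumes "invertible (A::complex^'n^'n)" shows "invertible (cadj A)"
proof (rule invertibleI)
  show "cadj A ** cadj (matrix_inv A) = mat 1"
    using matrix_inv_left[OF assms] by (simp add: cadj_mult[symmetric] cadj_mat)
qed

lemma invertible_factors:
  assumes "invertible (A ** B)" shows "invertible (A::complex^'n^'n)" "invertible (B::complex^'n^'n)"
  using assms by (simp_all add: invertible_det_nz det_mul)

lemma invertible_injI:
  assumes "\<And>x. A *v x = 0 \<Longrightarrow> x = 0" shows "invertible (A::complex^'n^'n)"
proof -
  obtain B where "B ** A = mat 1" using assms matrix_left_invertible_ker[of A] by blast
  then show ?thesis using invertibleI matrix_left_right_inverse by blast
qed

lemma matrix_inv_cramer: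
  assumes "invertible (A::complex^'n^'n)"
  shows "matrix_inv A $ i $ j =
    det (\<chi> a b. if b = i then axis j 1 $ a else A $ a $ b) / det A"
proof -
  have d: "det A \<noteq> 0" using assms invertible_det_nz by blast
  have "A *v (matrix_inv A *v axis j 1) = axis j 1"
    using matrix_inv_right[OF assms] by (simp add: matrix_vector_mul_assoc)
  then have "matrix_inv A *v axis j 1 =
      (\<chi> k. det (\<chi> a b. if b = k then axis j 1 $ a else A $ a $ b) / det A)"
    by (rule cramer[OF d, THEN iffD1])
  then have "(matrix_inv A *v axis j 1) $ i =
      det (\<chi> a b. if b = i then axis j 1 $ a else A $ a $ b) / det A" by simp
  then show ?thesis by simp
qed

text \<open>
The determinant is a polynomial in the entries, so it stays in any class of functions that contains the
constants and is closed under sums and products. This serves both holomorphy and real differentiability, and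
through Cramer's rule both pass on to the inverse matrix.
\<close>

lemma det_entries_closed:
  fixes F :: "'a \<Rightarrow> complex ^ 'n ^ 'n"
  assumes const: "\<And>c. P (\<lambda>w. c)"
    and add: "\<And>f g. P f \<Longrightarrow> P g \<Longrightarrow> P (\<lambda>w. f w + g w)"
    and mult: "\<And>f g. P f \<Longrightarrow> P g \<Longrightarrow> P (\<lambda>w. f w * g w)"
    and ent: "\<And>i j. P (\<lambda>w. F w $ i $ j)"
  shows "P (\<lambda>w. det (F w))"
proof -
  have sum: "P (\<lambda>w. \<Sum>x\<in>A. f x w)" if f: "\<And>x. P (f x)" for f :: "_ \<Rightarrow> 'a \<Rightarrow> complex" and A :: "('n \<Rightarrow> 'n) set"
  proof (induction A rule: infinite_finite_induct)
    case (insert x A)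
    show ?case using add[OF f[of x] insert.IH] insert.hyps by simp
  qed (use const[of 0] in simp_all)
  have prod: "P (\<lambda>w. \<Prod>x\<in>A. f x w)" if f: "\<And>x. P (f x)" for f and A :: "'n set"
  proof (induction A rule: infinite_finite_induct)
    case (insert x A)
    show ?case using mult[OF f[of x] insert.IH] insert.hyps by simp
  qed (use const[of 1] in simp_all)
  show ?thesis unfolding det_def by (rule sum, rule mult, rule const, rule prod, rule ent)
qed

lemma mat_holomorphic_on_mult:
  assumes "mat_holomorphic_on F D" "mat_holomorphic_on G D"
  shows "mat_holomorphic_on (\<lambda>z. F z ** G z) D"
  using assms unfolding mat_holomorphic_on_def matrix_matrix_mult_def
  by (auto intro!: holomorphic_intros)

lemma mat_holomorphic_on_const [simp]: "mat_holomorphic_on (\<lambda>z. A) D"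
  unfolding mat_holomorphic_on_def by simp

lemma mat_holomorphic_on_subset:
  "mat_holomorphic_on F D \<Longrightarrow> E \<subseteq> D \<Longrightarrow> mat_holomorphic_on F E"
  unfolding mat_holomorphic_on_def using holomorphic_on_subset by blast

lemma holomorphic_on_det:
  "mat_holomorphic_on F D \<Longrightarrow> (\<lambda>z. det (F z :: complex^'n^'n)) holomorphic_on D"
  by (rule det_entries_closed[where P = "\<lambda>f. f holomorphic_on D"])
    (auto simp: mat_holomorphic_on_def intro: holomorphic_intros)

lemma mat_holomorphic_on_inv:
  assumes F: "mat_holomorphic_on F D" and inv: "\<And>z. z \<in> D \<Longrightarrow> invertible (F z :: complex^'n^'n)"
  shows "mat_holomorphic_on (\<lambda>z. matrix_inv (F z)) D"
  unfolding mat_holomorphic_on_def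
proof (intro allI)
  fix i j
  have "(\<lambda>z. det (\<chi> a b. if b = i then axis j 1 $ a else F z $ a $ b) / det (F z)) holomorphic_on D"
  proof (intro holomorphic_on_divide holomorphic_on_det F)
    show "mat_holomorphic_on (\<lambda>z. \<chi> a b. if b = i then axis j 1 $ a else F z $ a $ b) D"
      unfolding mat_holomorphic_on_def
    proof (intro allI)
      fix i' j'
      show "(\<lambda>z. (\<chi> a b. if b = i then axis j 1 $ a else F z $ a $ b) $ i' $ j') holomorphic_on D"
        using F by (cases "j' = i") (simp_all add: mat_holomorphic_on_def)
    qed
  qed (use inv invertible_det_nz in blast)
  then show "(\<lambda>z. matrix_inv (F z) $ i $ j) holomorphic_on D"
    by (rule holomorphic_transform) (simp add: matrix_inv_cramer inv)
qed

lemma differentiable_det: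
  fixes F :: "complex \<Rightarrow> complex ^ 'n ^ 'n"
  assumes "\<And>i j. (\<lambda>w. F w $ i $ j) differentiable (at z)"
  shows "(\<lambda>w. det (F w)) differentiable (at z)"
  by (rule det_entries_closed[where P = "\<lambda>f. f differentiable (at z)"]) (use assms in auto)

lemma differentiable_matrix_inv:
  fixes F :: "complex \<Rightarrow> complex ^ 'n ^ 'n"
  assumes d: "\<And>i j. (\<lambda>w. F w $ i $ j) differentiable (at z)"
    and D: "open D" "z \<in> D" and inv: "\<And>z. z \<in> D \<Longrightarrow> invertible (F z)"
  shows "(\<lambda>w. matrix_inv (F w) $ i $ j) differentiable (at z)"
proof -
  have "(\<lambda>w. det (\<chi> a b. if b = i then axis j 1 $ a else F w $ a $ b) / det (F w)) differentiable (at z)"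
  proof (intro differentiable_divide differentiable_det)
    show "(\<lambda>w. (\<chi> a b. if b = i then axis j 1 $ a else F w $ a $ b) $ i' $ j') differentiable (at z)" for i' j'
      using d by (cases "j' = i") simp_all
    show "det (F z) \<noteq> 0" using inv D invertible_det_nz by blast
  qed (use d in auto)
  moreover have "matrix_inv (F w) $ i $ j = 
      det (\<chi> a b. if b = i then axis j 1 $ a else F w $ a $ b) / det (F w)" if "w \<in> D" for w
    using matrix_inv_cramer inv that by blast
  ultimately show ?thesis
    using D unfolding differentiable_def
    by (metis (no_types, lifting) has_derivative_transform_within_open)
qed

lemma differentiable_matrix_mult:
  fixes F G :: "complex \<Rightarrow> complex ^ 'n ^ 'n"
  assumes "\<And>i j. (\<lambda>w. F w $ i $ j) differentiable (at z)" "\<And>i j. (\<lambda>w. G w $ i $ j) differentiable (at z)"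
  shows "(\<lambda>w. (F w ** G w) $ i $ j) differentiable (at z)"
  using assms unfolding matrix_matrix_mult_def by auto

lemma matrix_cancel_left:
  assumes "invertible (P::complex^'n^'n)" "P ** X = P ** Y" shows "X = Y"
proof -
  have "matrix_inv P ** (P ** X) = matrix_inv P ** (P ** Y)" using assms(2) by (rule arg_cong)
  then show ?thesis by (simp only: matrix_mul_assoc matrix_inv_left[OF assms(1)] matrix_mul_lid)
qed

lemma matrix_cancel_right:
  assumes "invertible (P::complex^'n^'n)" "X ** P = Y ** P" shows "X = Y"
proof -
  have "X ** P ** matrix_inv P = Y ** P ** matrix_inv P" by (simp only: assms(2))
  then show ?thesis by (simp only: matrix_mul_assoc[symmetric] matrix_inv_right[OF assms(1)] matrix_mul_rid)
qed

lemma matrix_mult_entry_bound: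
  fixes A B :: "complex^'n^'n"
  assumes "\<And>i j. norm (A $ i $ j) \<le> a" "\<And>i j. norm (B $ i $ j) \<le> b"
  shows "norm ((A ** B) $ i $ j) \<le> real CARD('n) * (a * b)"
proof -
  have a: "a \<ge> 0" using assms(1) norm_ge_zero order_trans by blast
  have "(A ** B) $ i $ j = (\<Sum>k\<in>UNIV. A $ i $ k * B $ k $ j)" by (simp add: matrix_matrix_mult_def)
  also have "norm \<dots> \<le> (\<Sum>k\<in>(UNIV::'n set). a * b)"
    by (intro sum_norm_le) (simp add: norm_mult mult_mono a assms)
  finally show ?thesis by simp
qed

lemma mat_holomorphic_bounded:
  fixes F :: "complex \<Rightarrow> complex^'n^'n"
  assumes F: "mat_holomorphic_on F D" and K: "compact K" "K \<subseteq> D"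
  shows "\<exists>N. \<forall>z\<in>K. \<forall>i j. norm (F z $ i $ j) \<le> N"
proof -
  have "continuous_on K (\<lambda>z. \<chi> i j. F z $ i $ j)"
    using F K unfolding mat_holomorphic_on_def
    by (intro continuous_on_vec_lambda) (meson holomorphic_on_imp_continuous_on continuous_on_subset)
  then have "continuous_on K F" by (simp add: vec_lambda_eta)
  then have "bounded (F ` K)" using K compact_continuous_image compact_imp_bounded by blast
  then obtain N where N: "\<And>z. z \<in> K \<Longrightarrow> norm (F z) \<le> N" unfolding bounded_iff by blast
  have "norm (F z $ i $ j) \<le> N" if "z \<in> K" for z i j
    using Finite_Cartesian_Product.norm_nth_le[of "F z $ i" j] 
      Finite_Cartesian_Product.norm_nth_le[of "F z" i] N[OF that] by linarith
  then show ?thesis by blast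
qed

lemma scaleC_vec_eq: "a *\<^sub>C (v :: complex ^ 'n) = a *s v"
  by (simp add: scaleC_vec_def scaleC_complex_def vector_scalar_mult_def)

lemma matrix_vector_mult_smult: "(A :: complex^'n^'m) *v (a *s x) = a *s (A *v x)"
  by (simp add: vec_eq_iff matrix_vector_mult_def sum_distrib_left mult.left_commute)

section \<open>Polynomials in a matrix and positive square roots\<close>

text \<open>
Horner's scheme with the matrix product. The multiplication that the type class structure puts on matrices is
the entrywise one, so \<^const>\<open>poly\<close> would compute something else.
\<close>

definition poly_mat :: "complex ^ 'n ^ 'n \<Rightarrow> complex poly \<Rightarrow> complex ^ 'n ^ 'n" where
  "poly_mat M p = fold_coeffs (\<lambda>a X. mat a + M ** X) p 0"

lemma mat_0 [simp]: "mat 0 = (0::complex^'n^'n)"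
  by (simp add: mat_def vec_eq_iff)

lemma mat_mult_nth: "(mat a ** M) $ i $ j = a * (M::complex^'n^'n) $ i $ j"
proof -
  have "(mat a ** M) $ i $ j = (\<Sum>k\<in>UNIV. if k = i then a * M $ k $ j else 0)"
    unfolding matrix_matrix_mult_def mat_def vec_lambda_beta by (rule sum.cong) auto
  then show ?thesis by simp
qed

lemma mult_mat_nth: "(M ** mat a) $ i $ j = a * (M::complex^'n^'n) $ i $ j"
proof -
  have "(M ** mat a) $ i $ j = (\<Sum>k\<in>UNIV. if k = j then a * M $ i $ k else 0)"
    unfolding matrix_matrix_mult_def mat_def vec_lambda_beta by (rule sum.cong) auto
  then show ?thesis by simp
qed

lemma matrix_add_rdistrib: "(A + B) ** (C::complex^'n^'m) = A ** C + B ** C"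
  by (simp add: vec_eq_iff matrix_matrix_mult_def distrib_right sum.distrib)

lemma mat_commute: "mat a ** (M::complex^'n^'n) = M ** mat a"
  by (simp add: vec_eq_iff mat_mult_nth mult_mat_nth)

lemma mat_add: "mat (a + b) = mat a + (mat b::complex^'n^'n)"
  by (simp add: vec_eq_iff mat_def)

lemma mat_mat: "mat (a * b) = mat a ** (mat b::complex^'n^'n)"
  by (simp add: vec_eq_iff mat_mult_nth) (simp add: mat_def)

lemma mat_mult_vec: "mat a *v (x::complex^'n) = a *s x"
proof -
  have "(mat a *v x) $ i = (\<Sum>k\<in>UNIV. if k = i then a * x $ k else 0)" for i
    unfolding matrix_vector_mult_def mat_def vec_lambda_beta by (rule sum.cong) auto
  then show ?thesis by (simp add: vec_eq_iff)
qed

lemma poly_mat_0 [simp]: "poly_mat M 0 = 0"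
  by (simp add: poly_mat_def)

lemma poly_mat_pCons [simp]: "poly_mat M (pCons a p) = mat a + M ** poly_mat M p"
  by (cases "a = 0 \<and> p = 0") (auto simp: poly_mat_def)

lemma poly_mat_add: "poly_mat M (p + q) = poly_mat M p + poly_mat M q"
proof (induction p arbitrary: q)
  case (pCons a p)
  show ?case by (cases q) (simp add: pCons.IH mat_add matrix_add_ldistrib)
qed simp

lemma poly_mat_smult: "poly_mat M (smult a p) = mat a ** poly_mat M p"
  by (induction p) (simp_all add: mat_mat matrix_add_ldistrib matrix_mul_assoc mat_commute[of a M])

lemma poly_mat_mult: "poly_mat M (p * q) = poly_mat M p ** poly_mat M q"
  by (induction p)
    (simp_all add: poly_mat_add poly_mat_smult matrix_add_rdistrib matrix_mul_assoc)

text \<open>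
A relation \<open>C K = K D\<close> survives applying a polynomial to \<open>C\<close> and \<open>D\<close>. It is used both for similarity,
with \<open>K\<close> invertible, and for the commutation rule between a multiplier and a reproducing kernel.
\<close>

lemma poly_mat_intertwine:
  fixes C K D :: "complex^'n^'n"
  assumes "C ** K = K ** D" shows "poly_mat C p ** K = K ** poly_mat D p"
proof (induction p)
  case (pCons a p)
  have "poly_mat C (pCons a p) ** K = mat a ** K + C ** (poly_mat C p ** K)"
    by (simp add: matrix_add_rdistrib matrix_mul_assoc)
  also have "\<dots> = K ** mat a + (C ** K) ** poly_mat D p"
    by (simp add: pCons.IH mat_commute[of a K] matrix_mul_assoc)
  also have "\<dots> = K ** poly_mat D (pCons a p)"
    by (simp add: assms matrix_add_ldistrib matrix_mul_assoc)
  finally show ?case .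
qed simp

lemma poly_mat_cadj: "cadj (poly_mat M (map_poly of_real p)) = poly_mat (cadj M) (map_poly of_real p)"
proof (induction p)
  case 0
  then show ?case by (simp add: vec_eq_iff)
next
  case (pCons a p)
  let ?p = "map_poly of_real p"
  have "cadj (poly_mat M (map_poly of_real (pCons a p))) = mat (of_real a) + cadj (poly_mat M ?p) ** cadj M"
    by (simp add: map_poly_pCons cadj_add cadj_mult cadj_mat)
  also have "cadj (poly_mat M ?p) ** cadj M = cadj M ** poly_mat (cadj M) ?p"
    using poly_mat_intertwine[of "cadj M" "cadj M" "cadj M"] by (simp add: pCons.IH)
  finally show ?case by (simp add: map_poly_pCons)
qed

text \<open>
The matrices form a finite-dimensional real vector space, so the powers of \<open>M\<close> are linearly dependent. The
powers need not be distinct; if two of them coincide, their difference already gives the polynomial.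
\<close>

lemma annihilating_polynomial: "\<exists>q. q \<noteq> 0 \<and> poly_mat (M :: complex^'n^'n) q = 0"
proof -
  define f where "f k = poly_mat M (monom 1 k)" for k
  define N where "N = DIM(complex^'n^'n)"
  show ?thesis
  proof (cases "inj_on f {..N}")
    case False
    then obtain i j where ij: "i \<noteq> j" "f i = f j" unfolding inj_on_def by blast
    have "poly_mat M (monom 1 i + smult (-1) (monom 1 j)) = f i + mat (-1) ** f j"
      by (simp only: poly_mat_add poly_mat_smult f_def)
    also have "\<dots> = 0" using ij by (simp add: vec_eq_iff mat_mult_nth)
    finally have "poly_mat M (monom 1 i + smult (-1) (monom 1 j)) = 0" .
    moreover have "monom 1 i + smult (-1) (monom 1 j) \<noteq> (0::complex poly)"
    proof
      assume "monom 1 i + smult (-1) (monom 1 j) = (0::complex poly)"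
      then have "coeff (monom 1 i + smult (-1) (monom 1 j)) i = (0::complex)" by simp
      then show False using ij by simp
    qed
    ultimately show ?thesis by blast
  next
    case True
    then have "card (f ` {..N}) = N + 1" by (simp add: card_image)
    then have "dependent (f ` {..N})"
      using independent_bound[of "f ` {..N}"] unfolding N_def by linarith
    then obtain u where u: "\<exists>v\<in>f ` {..N}. u v \<noteq> 0" "(\<Sum>v\<in>f ` {..N}. u v *\<^sub>R v) = 0"
      by (auto simp: dependent_finite)
    define q where "q = (\<Sum>k\<le>N. smult (complex_of_real (u (f k))) (monom 1 k))"
    have "poly_mat M q = (\<Sum>k\<le>N. u (f k) *\<^sub>R f k)"
    proof -
      have "poly_mat M (\<Sum>k\<in>A. smult (complex_of_real (u (f k))) (monom 1 k)) = (\<Sum>k\<in>A. u (f k) *\<^sub>R f k)"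
        if "finite A" for A
        using that
      proof (induction A)
        case (insert a A)
        have "mat (complex_of_real (u (f a))) ** f a = u (f a) *\<^sub>R f a"
          by (simp add: vec_eq_iff mat_mult_nth scaleR_conv_of_real[where 'a = complex])
        then show ?case using insert
          by (simp add: poly_mat_add poly_mat_smult del: f_def) (simp add: f_def)
      qed simp
      then show ?thesis unfolding q_def by simp
    qed
    also have "\<dots> = 0" using u(2) True by (simp add: sum.reindex)
    finally have "poly_mat M q = 0" .
    moreover have "q \<noteq> 0"
    proof -
      obtain k where k: "k \<le> N" "u (f k) \<noteq> 0" using u(1) by auto
      have "coeff q k = (\<Sum>i\<le>N. if i = k then of_real (u (f i)) else 0)"
        unfolding q_def coeff_sum by (rule sum.cong) auto
      then have "coeff q k = of_real (u (f k))" using k by simp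
      then show ?thesis using k by auto
    qed
    ultimately show ?thesis by blast
  qed
qed

lemma poly_mat_mult_vec: "poly_mat M (p * q) *v v = poly_mat M p *v (poly_mat M q *v v)"
  by (simp add: poly_mat_mult matrix_vector_mul_assoc)

lemma poly_mat_linear_vec: "poly_mat M [:- a, 1:] *v v = M *v v - a *s v"
proof -
  have "poly_mat M [:- a, 1:] *v v = mat (- a) *v v + M *v v"
    by (simp add: matrix_vector_mult_add_rdistrib)
  then show ?thesis by (simp add: mat_mult_vec)
qed

lemma interpolation:
  fixes A :: "'a::field set"
  assumes "finite A" shows "\<exists>p. \<forall>x\<in>A. poly p x = f x"
  using assms
proof (induction A)
  case (insert a A)
  then obtain p where p: "\<forall>x\<in>A. poly p x = f x" by blast
  define w where "w = (\<Prod>x\<in>A. [:- x, 1:])"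
  have w0: "poly w x = 0" if "x \<in> A" for x
    unfolding w_def poly_prod using insert that by auto
  have wa: "poly w a \<noteq> 0"
    unfolding w_def poly_prod using insert by auto
  have "\<forall>x\<in>insert a A. poly (p + smult ((f a - poly p a) / poly w a) w) x = f x"
    using p w0 wa by auto
  then show ?case by blast
qed simp

lemma prod_linear_dvd:
  fixes r :: "'a::field poly"
  assumes "finite E" "\<And>a. a \<in> E \<Longrightarrow> poly r a = 0"
  shows "(\<Prod>a\<in>E. [:- a, 1:]) dvd r"
  using assms
proof (induction E)
  case (insert a E)
  then obtain s where s: "r = (\<Prod>a\<in>E. [:- a, 1:]) * s" by (meson dvdE insertCI)
  have "poly (\<Prod>a\<in>E. [:- a, 1:]) a \<noteq> 0"
    unfolding poly_prod using insert by auto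
  moreover have "poly r a = 0" using insert by blast
  ultimately have "poly s a = 0" by (simp add: s)
  then obtain t where t: "s = [:- a, 1:] * t" by (metis dvdE poly_eq_0_iff_dvd)
  then have "r = (\<Prod>a\<in>insert a E. [:- a, 1:]) * t"
    unfolding s t prod.insert[OF insert.hyps] by (simp only: mult_ac)
  then show ?case by (rule dvdI)
qed simp

text \<open>
Hermitian symmetry is included: over the complex numbers it amounts to the quadratic form having real values.
\<close>

definition pos_def :: "complex ^ 'n ^ 'n \<Rightarrow> bool" where
  "pos_def A \<longleftrightarrow> (\<forall>x. x \<noteq> 0 \<longrightarrow> cvec_inner (A *v x) x \<in> \<real> \<and> 0 < Re (cvec_inner (A *v x) x))"

lemma pos_def_imp_invertible:
  assumes "pos_def (A::complex^'n^'n)" shows "invertible A"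
proof (rule invertible_injI, rule ccontr)
  fix x assume "A *v x = 0" "x \<noteq> 0"
  then show False using assms unfolding pos_def_def by (metis cvec_inner_zero(1) less_irrefl zero_complex.sel(1))
qed

lemma pos_def_congruence:
  assumes A: "pos_def (A::complex^'n^'n)" and P: "invertible (P::complex^'n^'n)"
  shows "pos_def (P ** A ** cadj P)"
  unfolding pos_def_def
proof (intro allI impI)
  fix x :: "complex^'n" assume x: "x \<noteq> 0"
  obtain Q where Q: "Q ** cadj P = mat 1" using matrix_inv_left[OF invertible_cadj[OF P]] by blast
  have "cadj P *v x \<noteq> 0"
  proof
    assume "cadj P *v x = 0"
    then have "(Q ** cadj P) *v x = 0"
      by (simp only: matrix_vector_mul_assoc[symmetric] matrix_vector_mult_0_right)
    then show False using Q x by simp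
  qed
  moreover have "cvec_inner ((P ** A ** cadj P) *v x) x = cvec_inner (A *v (cadj P *v x)) (cadj P *v x)"
    by (simp only: cvec_inner_mult_left[of P] matrix_vector_mul_assoc[symmetric])
  ultimately show "cvec_inner ((P ** A ** cadj P) *v x) x \<in> \<real> \<and>
      0 < Re (cvec_inner ((P ** A ** cadj P) *v x) x)"
    using A by (simp add: pos_def_def)
qed

text \<open>
The condition \<open>k M = M\<^sup>* k\<close> says that \<open>M\<close> is self-adjoint for the inner product \<open>\<langle>k x, y\<rangle>\<close>, and positivity of
\<open>k M\<close> that \<open>M\<close> is positive for it. Any annihilating polynomial can then be thinned out, one linear factor
at a time: a factor \<open>M - a\<close> with \<open>a\<close> not a positive real is injective and can be cancelled, and a repeated
factor can be dropped since \<open>M - a\<close> and its square have the same kernel. What remains is a product of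
distinct linear factors with positive roots; this replaces the diagonalization of \<open>M\<close>.
\<close>

lemma selfadjoint_squarefree_annihilator:
  fixes M k :: "complex ^ 'n ^ 'n"
  assumes sa: "k ** M = cadj M ** k" and k: "pos_def k" and kM: "pos_def (k ** M)"
    and q: "q \<noteq> 0"
  shows "\<exists>E. finite E \<and> E \<subseteq> of_real ` {0<..} \<and>
    (\<forall>v. poly_mat M q *v v = 0 \<longrightarrow> poly_mat M (\<Prod>a\<in>E. [:- a, 1:]) *v v = 0)"
  using q
proof (induction "degree q" arbitrary: q)
  case 0
  then obtain c where c: "q = [:c:]" "c \<noteq> 0" by (metis degree_eq_zeroE pCons_0_0)
  have "v = 0" if "poly_mat M q *v v = 0" for v
    using that c by (simp add: mat_mult_vec)
  then have "poly_mat M (\<Prod>a\<in>{}. [:- a, 1:]) *v v = 0" if "poly_mat M q *v v = 0" for v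
    using that by (metis matrix_vector_mult_0_right)
  then show ?case by blast
next
  case (Suc d)
  then obtain a where "poly q a = 0"
    using fundamental_theorem_of_algebra[of q] constant_degree[of q] by auto
  then obtain r where r: "q = r * [:- a, 1:]" by (metis dvdE poly_eq_0_iff_dvd mult.commute)
  have r0: "r \<noteq> 0" using r Suc.prems by auto
  have "degree q = degree r + 1" using r0 by (simp add: r degree_mult_eq del: mult_pCons_right)
  then have "d = degree r" using Suc.hyps by simp
  then obtain E where E: "finite E" "E \<subseteq> of_real ` {0<..}"
      "\<And>v. poly_mat M r *v v = 0 \<Longrightarrow> poly_mat M (\<Prod>a\<in>E. [:- a, 1:]) *v v = 0"
    using Suc.hyps(1) r0 by blast
  let ?L = "\<lambda>v. poly_mat M [:- a, 1:] *v v"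
  have step: "poly_mat M ([:- a, 1:] * (\<Prod>a\<in>E. [:- a, 1:])) *v v = 0" if "poly_mat M q *v v = 0" for v
  proof -
    have "poly_mat M r *v ?L v = 0" using that by (simp only: r poly_mat_mult_vec)
    then have "poly_mat M ((\<Prod>a\<in>E. [:- a, 1:]) * [:- a, 1:]) *v v = 0"
      unfolding poly_mat_mult_vec by (rule E)
    then show ?thesis by (simp only: mult.commute)
  qed
  \<comment> \<open>An eigenvalue is the quotient of two values of positive definite forms.\<close>
  have eig: "v = 0" if a: "a \<notin> of_real ` {0<..}" and L: "?L v = 0" for v
  proof (rule ccontr)
    assume v: "v \<noteq> 0"
    have "M *v v = a *s v" using L unfolding poly_mat_linear_vec by simp
    then have e: "cvec_inner ((k ** M) *v v) v = a * cvec_inner (k *v v) v"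
      by (simp add: matrix_vector_mul_assoc[symmetric] cvec_inner_scale_left vector_scalar_commute)
    have r1: "cvec_inner (k *v v) v \<in> \<real>" "0 < Re (cvec_inner (k *v v) v)"
      using k v unfolding pos_def_def by auto
    have r2: "cvec_inner ((k ** M) *v v) v \<in> \<real>" "0 < Re (cvec_inner ((k ** M) *v v) v)"
      using kM v unfolding pos_def_def by auto
    obtain s t where st: "cvec_inner (k *v v) v = of_real s" "cvec_inner ((k ** M) *v v) v = of_real t"
      using r1 r2 by (meson Reals_cases)
    then have "s > 0" "t > 0" using r1 r2 by auto
    moreover have "a = of_real (t / s)" using e st \<open>s > 0\<close> by (simp add: field_simps)
    ultimately show False using a by (metis divide_pos_pos greaterThan_iff imageI)
  qed
  \<comment> \<open>With \<open>x = (M - a) u\<close>, self-adjointness turns \<open>\<langle>k x, x\<rangle>\<close> into \<open>\<langle>k u, (M - a) x\<rangle> = 0\<close>.\<close>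
  have square: "?L u = 0" if a: "a \<in> of_real ` {0<..}" and L: "?L (?L u) = 0" for u
  proof (rule ccontr)
    define x where "x = ?L u"
    assume "?L u \<noteq> 0"
    then have "x \<noteq> 0" by (simp add: x_def)
    have ra: "cnj a = a" using a by auto
    have sa': "k ** poly_mat M [:- a, 1:] = cadj (poly_mat M [:- a, 1:]) ** k"
      using sa ra by (simp add: cadj_add cadj_mat matrix_add_ldistrib matrix_add_rdistrib mat_commute)
    have "cvec_inner (k *v x) x = cvec_inner ((k ** poly_mat M [:- a, 1:]) *v u) x"
      by (simp only: x_def matrix_vector_mul_assoc)
    also have "\<dots> = cvec_inner (k *v u) (?L x)"
      by (simp only: sa' matrix_vector_mul_assoc[symmetric] cvec_inner_mult_left cadj_cadj)
    also have "\<dots> = 0" using L by (simp only: x_def cvec_inner_zero)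
    finally have "cvec_inner (k *v x) x = 0" .
    then show False using k \<open>x \<noteq> 0\<close> unfolding pos_def_def by fastforce
  qed
  consider "a \<notin> of_real ` {0<..}" | "a \<in> of_real ` {0<..}" "a \<in> E" | "a \<in> of_real ` {0<..}" "a \<notin> E"
    by blast
  then show ?case
  proof cases
    case 1
    then show ?thesis using E(1,2) step[unfolded poly_mat_mult_vec] eig by blast
  next
    case 2
    have "(\<Prod>a\<in>E. [:- a, 1:]) = [:- a, 1:] * (\<Prod>a\<in>E - {a}. [:- a, 1:])"
      using E(1) 2 by (simp only: prod.remove)
    then show ?thesis using E(1,2) step square[OF 2(1)]
      by (intro exI[of _ E]) (auto simp only: poly_mat_mult_vec)
  next
    case 3
    have "(\<Prod>a\<in>insert a E. [:- a, 1:]) = [:- a, 1:] * (\<Prod>a\<in>E. [:- a, 1:])"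
      by (rule prod.insert[OF E(1) 3(2)])
    then have "\<forall>v. poly_mat M q *v v = 0 \<longrightarrow> poly_mat M (\<Prod>a\<in>insert a E. [:- a, 1:]) *v v = 0"
      using step by (simp only:)  blast
    then show ?thesis using E(1,2) 3(1) by (intro exI[of _ "insert a E"]) blast
  qed
qed

text \<open>
Let \<open>p\<close> interpolate the square root on the finite set \<open>E\<close> of positive roots. Then \<open>p\<^sup>2 - x\<close> vanishes on \<open>E\<close>,
hence is a multiple of the annihilating product, and so \<open>p(M)\<^sup>2 = M\<close>. That \<open>p\<close> has real coefficients is what
makes it compatible with conjugate transposition later on.
\<close>

proposition selfadjoint_positive_polynomial_sqrt:
  fixes M k :: "complex ^ 'n ^ 'n"
  assumes sa: "k ** M = cadj M ** k" and k: "pos_def k" and kM: "pos_def (k ** M)"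
  shows "\<exists>p :: real poly. poly_mat M (map_poly of_real p) ** poly_mat M (map_poly of_real p) = M"
proof -
  obtain q where q: "q \<noteq> 0" "poly_mat M q = 0" using annihilating_polynomial by blast
  obtain E where E: "finite E" "E \<subseteq> of_real ` {0<..}"
      "\<And>v. poly_mat M q *v v = 0 \<Longrightarrow> poly_mat M (\<Prod>a\<in>E. [:- a, 1:]) *v v = 0"
    using selfadjoint_squarefree_annihilator[OF sa k kM q(1)] by blast
  have z: "poly_mat M (\<Prod>a\<in>E. [:- a, 1:]) = 0"
    by (rule matrix_eq_vectorI) (use E(3) q(2) in simp)
  obtain p where p: "\<forall>x\<in>Re ` E. poly p x = sqrt x"
    using interpolation[of "Re ` E" sqrt] E(1) by auto
  let ?p = "map_poly complex_of_real p"
  have ev: "poly ?p (of_real x) = of_real (poly p x)" for x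
    by (induction p) (simp_all add: map_poly_pCons)
  have "poly (?p * ?p + [:0, -1:]) a = 0" if aE: "a \<in> E" for a
  proof -
    obtain x where x: "a = of_real x" "x > 0"
      using subsetD[OF E(2) aE] by (auto simp: image_iff)
    then have "poly p x = sqrt x" using p aE by force
    then show ?thesis using x by (simp add: ev flip: of_real_mult)
  qed
  then have "(\<Prod>a\<in>E. [:- a, 1:]) dvd ?p * ?p + [:0, -1:]"
    using prod_linear_dvd[OF E(1)] by blast
  then obtain s where s: "?p * ?p + [:0, -1:] = (\<Prod>a\<in>E. [:- a, 1:]) * s" by (elim dvdE)
  have "poly_mat M ?p ** poly_mat M ?p + poly_mat M [:0, -1:] = poly_mat M (?p * ?p + [:0, -1:])"
    by (simp only: poly_mat_add poly_mat_mult)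
  also have "\<dots> = 0" by (simp only: s poly_mat_mult z) simp
  finally have "poly_mat M ?p ** poly_mat M ?p + M ** mat (-1) = 0" by simp
  moreover have "M ** mat (-1) = - M" by (simp add: vec_eq_iff mult_mat_nth)
  ultimately have "poly_mat M ?p ** poly_mat M ?p = M" by simp
  then show ?thesis by blast
qed

section \<open>Orthogonality and density in a Hilbert space\<close>

context complex_hilbert_space
begin

lemma carrier_zero [simp]: "0 \<in> H"
  using subspace_carrier by (rule cvs.subspace_0)

lemma carrier_add [simp]: "x \<in> H \<Longrightarrow> y \<in> H \<Longrightarrow> x + y \<in> H"
  using subspace_carrier by (rule cvs.subspace_add)

lemma carrier_diff [simp]: "x \<in> H \<Longrightarrow> y \<in> H \<Longrightarrow> x - y \<in> H"
  using subspace_carrier by (rule cvs.subspace_diff)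

lemma carrier_scale [simp]: "x \<in> H \<Longrightarrow> a *\<^sub>C x \<in> H"
  using subspace_carrier by (rule cvs.subspace_scale)

lemma ip_diff_left:
  assumes "x \<in> H" "y \<in> H" "z \<in> H" shows "ip (x - y) z = ip x z - ip y z"
  using ip_add_left[of "x - y" y z] assms by simp

lemma ip_add_right:
  assumes "x \<in> H" "y \<in> H" "z \<in> H" shows "ip z (x + y) = ip z x + ip z y"
  using assms ip_add_left[of x y z] ip_cnj[of _ z] by (metis carrier_add complex_cnj_add)

lemma ip_scaleC_right:
  assumes "x \<in> H" "y \<in> H" shows "ip x (a *\<^sub>C y) = cnj a * ip x y"
  using assms ip_scaleC_left[of y x a] ip_cnj[of _ x] by (metis carrier_scale complex_cnj_mult)

lemma ip_diff_right:
  assumes "x \<in> H" "y \<in> H" "z \<in> H" shows "ip z (x - y) = ip z x - ip z y"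
  using ip_add_right[of "x - y" y z] assms by simp

lemma ip_zero_left [simp]: "x \<in> H \<Longrightarrow> ip 0 x = 0"
  using ip_diff_left[of x x x] by simp

lemma ip_zero_right [simp]: "x \<in> H \<Longrightarrow> ip x 0 = 0"
  using ip_diff_right[of x x x] by simp

lemma ip_self: "x \<in> H \<Longrightarrow> ip x x = of_real ((hnorm ip x)\<^sup>2)"
  using ip_cnj[of x x] ip_nonneg[of x] by (simp add: hnorm_def complex_eq_iff)

lemma hnorm_nonneg [simp]: "x \<in> H \<Longrightarrow> 0 \<le> hnorm ip x"
  using ip_nonneg by (simp add: hnorm_def)

lemma hnorm_sq: "x \<in> H \<Longrightarrow> (hnorm ip x)\<^sup>2 = Re (ip x x)"
  using ip_nonneg by (simp add: hnorm_def)

lemma hnorm_eq_0: "x \<in> H \<Longrightarrow> hnorm ip x = 0 \<longleftrightarrow> x = 0"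
  using ip_self ip_definite by fastforce

lemma hnorm_minus_commute:
  assumes "x \<in> H" "y \<in> H" shows "hnorm ip (x - y) = hnorm ip (y - x)"
  using assms by (simp add: hnorm_def ip_diff_left ip_diff_right algebra_simps)

lemma hnorm_sq_diff_scale:
  assumes "x \<in> H" "y \<in> H"
  shows "(hnorm ip (x - a *\<^sub>C y))\<^sup>2 =
    (hnorm ip x)\<^sup>2 - 2 * Re (cnj a * ip x y) + (cmod a)\<^sup>2 * (hnorm ip y)\<^sup>2"
proof -
  have "ip (x - a *\<^sub>C y) (x - a *\<^sub>C y) =
      ip x x - cnj a * ip x y - a * cnj (ip x y) + (a * cnj a) * ip y y"
    using assms ip_cnj[OF assms]
    by (simp add: ip_diff_left ip_diff_right ip_scaleC_left ip_scaleC_right) (simp add: algebra_simps)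
  also have "a * cnj a = of_real ((cmod a)\<^sup>2)" by (rule complex_norm_square[symmetric])
  finally have "Re (ip (x - a *\<^sub>C y) (x - a *\<^sub>C y)) =
      Re (ip x x) - Re (cnj a * ip x y) - Re (a * cnj (ip x y)) + (cmod a)\<^sup>2 * Re (ip y y)"
    by (simp add: Re_complex_of_real)
  moreover have "Re (a * cnj (ip x y)) = Re (cnj a * ip x y)" by simp
  ultimately show ?thesis using assms by (simp add: hnorm_sq)
qed

text \<open>
Removing from \<open>x\<close> its component along \<open>y\<close>. The Cauchy-Schwarz inequality is the fact that the result is
nonnegative; read backwards, if subtracting multiples of \<open>y\<close> never makes \<open>x\<close> shorter, then \<open>x\<close> is orthogonal
to \<open>y\<close>.
\<close>

lemma hnorm_sq_diff_projection:
  assumes "x \<in> H" "y \<in> H" "y \<noteq> 0"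
  shows "(hnorm ip (x - (ip x y / ip y y) *\<^sub>C y))\<^sup>2 = (hnorm ip x)\<^sup>2 - (cmod (ip x y))\<^sup>2 / (hnorm ip y)\<^sup>2"
proof -
  define s where "s = (hnorm ip y)\<^sup>2"
  have s: "s > 0" using assms hnorm_eq_0 by (simp add: s_def)
  have a: "ip x y / ip y y = ip x y / of_real s" using assms ip_self by (simp add: s_def)
  have "cnj (ip x y / of_real s) * ip x y = of_real ((cmod (ip x y))\<^sup>2 / s)"
    using s complex_norm_square[of "ip x y"] by (simp add: mult.commute)
  then have "Re (cnj (ip x y / of_real s) * ip x y) = (cmod (ip x y))\<^sup>2 / s"
    by (simp only: Re_complex_of_real)
  moreover have "(cmod (ip x y / of_real s))\<^sup>2 * s = (cmod (ip x y))\<^sup>2 / s"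
    using s by (simp add: norm_divide power2_eq_square)
  ultimately show ?thesis
    unfolding a hnorm_sq_diff_scale[OF assms(1,2)] s_def[symmetric] by (simp only:)
qed

lemma cauchy_schwarz:
  assumes "x \<in> H" "y \<in> H" shows "cmod (ip x y) \<le> hnorm ip x * hnorm ip y"
proof (cases "y = 0")
  case True
  then show ?thesis using assms by simp
next
  case False
  then have s: "0 < (hnorm ip y)\<^sup>2" using assms hnorm_eq_0 by simp
  have "0 \<le> (hnorm ip x)\<^sup>2 - (cmod (ip x y))\<^sup>2 / (hnorm ip y)\<^sup>2"
    using hnorm_sq_diff_projection[OF assms False] by (metis zero_le_power2)
  then have "(cmod (ip x y))\<^sup>2 \<le> (hnorm ip x * hnorm ip y)\<^sup>2"
    using s by (simp add: field_simps power_mult_distrib)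
  then show ?thesis by (rule power2_le_imp_le) (use assms in simp)
qed

lemma hnorm_triangle:
  assumes "x \<in> H" "y \<in> H" shows "hnorm ip (x + y) \<le> hnorm ip x + hnorm ip y"
proof (rule power2_le_imp_le)
  have "Re (ip x y) \<le> hnorm ip x * hnorm ip y"
    using cauchy_schwarz[OF assms] complex_Re_le_cmod order_trans by blast
  moreover have "(hnorm ip (x + y))\<^sup>2 = (hnorm ip x)\<^sup>2 + 2 * Re (ip x y) + (hnorm ip y)\<^sup>2"
    using assms ip_cnj[OF assms] by (simp add: hnorm_sq ip_add_left ip_add_right)
  ultimately show "(hnorm ip (x + y))\<^sup>2 \<le> (hnorm ip x + hnorm ip y)\<^sup>2"
    by (simp add: power2_sum)
qed (use assms in simp)

lemma hnorm_triangle_sub: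
  assumes "x \<in> H" "y \<in> H" "z \<in> H" shows "hnorm ip (x - z) \<le> hnorm ip (x - y) + hnorm ip (y - z)"
  using hnorm_triangle[of "x - y" "y - z"] assms by simp

lemma parallelogram:
  assumes "x \<in> H" "y \<in> H"
  shows "(hnorm ip (x - y))\<^sup>2 = 2 * (hnorm ip x)\<^sup>2 + 2 * (hnorm ip y)\<^sup>2 - (hnorm ip (x + y))\<^sup>2"
  using assms by (simp add: hnorm_sq ip_add_left ip_add_right ip_diff_left ip_diff_right)

lemma tendsto_ip_left:
  assumes X: "\<And>k. X k \<in> H" and "x \<in> H" "y \<in> H" and lim: "(\<lambda>k. hnorm ip (X k - x)) \<longlonglongrightarrow> 0"
  shows "(\<lambda>k. ip (X k) y) \<longlonglongrightarrow> ip x y"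
proof -
  have "(\<lambda>k. ip (X k) y - ip x y) \<longlonglongrightarrow> 0"
  proof (rule Lim_null_comparison)
    show "\<forall>\<^sub>F k in sequentially. norm (ip (X k) y - ip x y) \<le> hnorm ip (X k - x) * hnorm ip y"
    proof (rule always_eventually, rule allI)
      fix k
      show "norm (ip (X k) y - ip x y) \<le> hnorm ip (X k - x) * hnorm ip y"
        using cauchy_schwarz[of "X k - x" y] assms(2,3) X[of k] by (simp only: ip_diff_left carrier_diff)
    qed
    show "(\<lambda>k. hnorm ip (X k - x) * hnorm ip y) \<longlonglongrightarrow> 0"
      using tendsto_mult_left_zero[OF lim] by blast
  qed
  then show ?thesis by (simp add: LIM_zero_iff)
qed

lemma tendsto_ip_right:
  assumes X: "\<And>k. X k \<in> H" and "x \<in> H" "y \<in> H" and lim: "(\<lambda>k. hnorm ip (X k - x)) \<longlonglongrightarrow> 0"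
  shows "(\<lambda>k. ip y (X k)) \<longlonglongrightarrow> ip y x"
proof -
  have "ip y (X k) = cnj (ip (X k) y)" for k using X assms(3) by (rule ip_cnj)
  moreover have "ip y x = cnj (ip x y)" using assms(2,3) by (rule ip_cnj)
  ultimately show ?thesis using tendsto_cnj[OF tendsto_ip_left[OF assms]] by simp
qed

text \<open>
The projection theorem in the form needed here. A sequence in \<open>V\<close> that minimizes the distance to \<open>f\<close> is Cauchy
by the parallelogram law, because the midpoint of two of its members lies in \<open>V\<close> and so is not closer than
the infimum. The limit \<open>h\<close> realizes the distance, hence \<open>f - h\<close> is orthogonal to \<open>V\<close> and vanishes.
\<close>

proposition orthogonally_total_imp_dense:
  assumes V: "cvs.subspace V" "V \<subseteq> H"
    and total: "\<And>g. g \<in> H \<Longrightarrow> (\<And>v. v \<in> V \<Longrightarrow> ip g v = 0) \<Longrightarrow> g = 0"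
    and f: "f \<in> H"
  shows "\<exists>X. (\<forall>k. X k \<in> V) \<and> (\<lambda>k. hnorm ip (X k - f)) \<longlonglongrightarrow> 0"
proof -
  let ?D = "(\<lambda>v. hnorm ip (f - v)) ` V"
  define d where "d = Inf ?D"
  have VH: "v \<in> H" if "v \<in> V" for v using that V by blast
  have bdd: "bdd_below ?D" by (rule bdd_belowI[of _ 0]) (use f VH in auto)
  have V0: "0 \<in> V" using V cvs.subspace_0 by blast
  have d_le: "d \<le> hnorm ip (f - v)" if "v \<in> V" for v
    unfolding d_def using bdd that by (intro cInf_lower) auto
  have d0: "d \<ge> 0"
    unfolding d_def using V0 f VH by (intro cInf_greatest) auto
  have "\<exists>v\<in>V. hnorm ip (f - v) < d + 1 / real (Suc k)" for k
  proof -
    have "d < d + 1 / real (Suc k)" by simp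
    moreover have "?D \<noteq> {}" using V0 by blast
    ultimately show ?thesis
      unfolding d_def using bdd by (subst (asm) cInf_less_iff) auto
  qed
  then obtain X where X: "\<And>k. X k \<in> V" "\<And>k. hnorm ip (f - X k) < d + 1 / real (Suc k)" by metis
  have XH: "X k \<in> H" for k using X VH by blast
  define b where "b k = (d + 1 / real (Suc k))\<^sup>2 - d\<^sup>2" for k
  have dlim: "(\<lambda>k. d + 1 / real (Suc k)) \<longlonglongrightarrow> d"
    using tendsto_add[OF tendsto_const LIMSEQ_inverse_real_of_nat, of d] by (simp add: inverse_eq_divide)
  then have blim: "b \<longlonglongrightarrow> 0"
    unfolding b_def using tendsto_diff[OF tendsto_power[OF dlim, of 2] tendsto_const[of "d\<^sup>2"]] by simp
  have cau: "(hnorm ip (X j - X k))\<^sup>2 \<le> 2 * b j + 2 * b k" for j k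
  proof -
    let ?m = "(1/2) *\<^sub>C (X j + X k)"
    have m: "?m \<in> V" using X V by (intro cvs.subspace_scale cvs.subspace_add) auto
    have two: "f - X j + (f - X k) = 2 *\<^sub>C (f - ?m)"
    proof -
      have "2 *\<^sub>C f = f + f" using scaleC_add_left[of 1 1 f] by (simp add: scaleC_one)
      moreover have "2 *\<^sub>C ?m = X j + X k" by (simp add: scaleC_scaleC scaleC_one)
      ultimately show ?thesis
        using scaleC_add_right[of 2 "f - ?m" "?m"] by (simp add: algebra_simps)
    qed
    have "(hnorm ip (X j - X k))\<^sup>2 = (hnorm ip ((f - X k) - (f - X j)))\<^sup>2" by simp
    also have "\<dots> = 2 * (hnorm ip (f - X k))\<^sup>2 + 2 * (hnorm ip (f - X j))\<^sup>2
        - (hnorm ip (f - X k + (f - X j)))\<^sup>2"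
      using f XH by (intro parallelogram) auto
    \<comment> \<open>The norm of \<open>2 (f - m)\<close> is computed as that of \<open>0 - (-2) (f - m)\<close>.\<close>
    also have "(hnorm ip (f - X k + (f - X j)))\<^sup>2 = 4 * (hnorm ip (f - ?m))\<^sup>2"
      using two f VH[OF m] hnorm_sq_diff_scale[of 0 "f - ?m" "-2"]
      by (simp add: add.commute hnorm_def[of ip 0] cvs.scale_minus_left)
    finally have "(hnorm ip (X j - X k))\<^sup>2 = 2 * (hnorm ip (f - X k))\<^sup>2 + 2 * (hnorm ip (f - X j))\<^sup>2
        - 4 * (hnorm ip (f - ?m))\<^sup>2" .
    moreover have "(hnorm ip (f - X k))\<^sup>2 \<le> (d + 1 / real (Suc k))\<^sup>2"
      using X(2)[of k] f XH by (intro power_mono) (auto intro: less_imp_le)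
    moreover have "(hnorm ip (f - X j))\<^sup>2 \<le> (d + 1 / real (Suc j))\<^sup>2"
      using X(2)[of j] f XH by (intro power_mono) (auto intro: less_imp_le)
    moreover have "d\<^sup>2 \<le> (hnorm ip (f - ?m))\<^sup>2"
      using d_le[OF m] d0 by (intro power_mono) auto
    ultimately show ?thesis unfolding b_def right_diff_distrib by linarith
  qed
  have "\<exists>N. \<forall>j\<ge>N. \<forall>k\<ge>N. hnorm ip (X j - X k) < e" if e: "e > 0" for e
  proof -
    obtain N where N: "\<And>k. k \<ge> N \<Longrightarrow> b k < e\<^sup>2 / 4"
      using order_tendstoD(2)[OF blim, of "e\<^sup>2 / 4"] e unfolding eventually_sequentially by auto
    have "hnorm ip (X j - X k) < e" if "j \<ge> N" "k \<ge> N" for j k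
    proof (rule power2_less_imp_less)
      show "(hnorm ip (X j - X k))\<^sup>2 < e\<^sup>2" using cau[of j k] N[OF that(1)] N[OF that(2)] by linarith
    qed (use e in simp)
    then show ?thesis by blast
  qed
  then obtain h where h: "h \<in> H" "(\<lambda>k. hnorm ip (X k - h)) \<longlonglongrightarrow> 0"
    using complete[of X] XH by blast
  have g: "f - h \<in> H" using f h by simp
  have upper: "hnorm ip (f - h) \<le> d"
  proof (rule LIMSEQ_le_const)
    show "(\<lambda>k. d + 1 / real (Suc k) + hnorm ip (X k - h)) \<longlonglongrightarrow> d"
      using tendsto_add[OF dlim h(2)] by simp
    have "hnorm ip (f - h) \<le> d + 1 / real (Suc k) + hnorm ip (X k - h)" for k
      using hnorm_triangle_sub[OF f XH[of k] h(1)] X(2)[of k] by linarith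
    then show "\<exists>N. \<forall>k\<ge>N. hnorm ip (f - h) \<le> d + 1 / real (Suc k) + hnorm ip (X k - h)" by blast
  qed
  have lower: "d \<le> hnorm ip (f - h - v)" if v: "v \<in> V" for v
  proof (rule LIMSEQ_le_const)
    show "(\<lambda>k. hnorm ip (f - h - v) + hnorm ip (X k - h)) \<longlonglongrightarrow> hnorm ip (f - h - v)"
      using tendsto_add[OF tendsto_const h(2)] by simp
    have "d \<le> hnorm ip (f - h - v) + hnorm ip (X k - h)" for k
    proof -
      have "d \<le> hnorm ip (f - (X k + v))"
        using X v V cvs.subspace_add by (intro d_le) blast
      also have "f - (X k + v) = f - v - X k" by simp
      also have "hnorm ip (f - v - X k) \<le> hnorm ip (f - v - h) + hnorm ip (h - X k)"
        using f VH[OF v] h XH by (intro hnorm_triangle_sub) auto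
      also have "f - v - h = f - h - v" by simp
      finally show ?thesis using hnorm_minus_commute[OF h(1) XH[of k]] by simp
    qed
    then show "\<exists>N. \<forall>k\<ge>N. d \<le> hnorm ip (f - h - v) + hnorm ip (X k - h)" by blast
  qed
  have "f - h = 0"
  proof (rule total[OF g])
    fix v assume v: "v \<in> V"
    show "ip (f - h) v = 0"
    proof (cases "v = 0")
      case True
      then show ?thesis using g by simp
    next
      case False
      have "(ip (f - h) v / ip v v) *\<^sub>C v \<in> V" using v V cvs.subspace_scale by blast
      then have "hnorm ip (f - h) \<le> hnorm ip (f - h - (ip (f - h) v / ip v v) *\<^sub>C v)"
        using upper lower order_trans by blast
      then have "(hnorm ip (f - h))\<^sup>2 \<le> (hnorm ip (f - h - (ip (f - h) v / ip v v) *\<^sub>C v))\<^sup>2"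
        using g by (intro power_mono) auto
      then have "(cmod (ip (f - h) v))\<^sup>2 / (hnorm ip v)\<^sup>2 \<le> 0"
        using hnorm_sq_diff_projection[OF g VH[OF v] False] by linarith
      moreover have "0 < (hnorm ip v)\<^sup>2" using False hnorm_eq_0 VH[OF v] by simp
      ultimately have "(cmod (ip (f - h) v))\<^sup>2 \<le> 0" by (simp add: divide_le_0_iff not_le[symmetric])
      then show ?thesis by simp
    qed
  qed
  then have "h = f" by simp
  then show ?thesis using X h by blast
qed

end

section \<open>Hermitian kernels and their factorization\<close>

text \<open>
What the local argument needs from a reproducing kernel. Antiholomorphy in the second variable follows from
Hermitian symmetry.
\<close>

definition bounded_kernel_on :: "complex set \<Rightarrow> (complex \<Rightarrow> complex \<Rightarrow> complex ^ 'n ^ 'n) \<Rightarrow> bool" where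
  "bounded_kernel_on B K \<longleftrightarrow>
    (\<forall>w\<in>B. mat_holomorphic_on (\<lambda>z. K z w) B) \<and> (\<forall>z\<in>B. \<forall>w\<in>B. cadj (K z w) = K w z) \<and>
    (\<forall>w\<in>B. pos_def (K w w)) \<and> (\<exists>N. \<forall>z\<in>B. \<forall>w\<in>B. \<forall>i j. norm (K z w $ i $ j) \<le> N)"

lemma
  assumes "bounded_kernel_on B K"
  shows bounded_kernel_on_holomorphic: "w \<in> B \<Longrightarrow> mat_holomorphic_on (\<lambda>z. K z w) B"
    and bounded_kernel_on_hermitian: "z \<in> B \<Longrightarrow> w \<in> B \<Longrightarrow> cadj (K z w) = K w z"
    and bounded_kernel_on_pos_def: "w \<in> B \<Longrightarrow> pos_def (K w w)"
    and bounded_kernel_on_bound: "\<exists>N. \<forall>z\<in>B. \<forall>w\<in>B. \<forall>i j. norm (K z w $ i $ j) \<le> N"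
  using assms unfolding bounded_kernel_on_def by simp_all

lemma bounded_kernel_on_antiholomorphic:
  assumes K: "bounded_kernel_on B K" and z: "z \<in> B"
  shows "(\<lambda>w. cnj (K z w $ i $ j)) holomorphic_on B"
proof -
  have "(\<lambda>w. K w z $ j $ i) holomorphic_on B"
    using bounded_kernel_on_holomorphic[OF K z] unfolding mat_holomorphic_on_def by blast
  moreover have "K w z $ j $ i = cnj (K z w $ i $ j)" if "w \<in> B" for w
    by (simp flip: bounded_kernel_on_hermitian[OF K z that])
  ultimately show ?thesis by (rule holomorphic_transform)
qed

lemma bounded_kernel_on_diagonal_differentiable:
  assumes K: "bounded_kernel_on (ball c r) K" and w: "w \<in> ball c r"
  shows "(\<lambda>w. K w w $ i $ j) differentiable (at w)"
proof -
  obtain N where N: "\<And>z w i j. z \<in> ball c r \<Longrightarrow> w \<in> ball c r \<Longrightarrow> norm (K z w $ i $ j) \<le> N"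
    using bounded_kernel_on_bound[OF K] by blast
  show ?thesis
  proof (rule sesquiholomorphic_diagonal_differentiable[of c r "\<lambda>z w. K z w $ i $ j"])
    show "(\<lambda>z. K z w $ i $ j) holomorphic_on ball c r" if "w \<in> ball c r" for w
      using bounded_kernel_on_holomorphic[OF K that] unfolding mat_holomorphic_on_def by blast
    show "(\<lambda>w. cnj (K z w $ i $ j)) holomorphic_on ball c r" if "z \<in> ball c r" for z
      using bounded_kernel_on_antiholomorphic[OF K that] .
    show "norm (K z w $ i $ j) \<le> N" if "z \<in> ball c r" "w \<in> ball c r" for z w
      using that by (rule N)
  qed (rule w)
qed

text \<open>
Boundedness of the kernels makes their restrictions to the diagonal real differentiable, and Cramer's rule
extends this to the quotient. Only then can the vanishing Wirtinger derivative be read as antiholomorphy.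
\<close>

lemma antiholomorphic_quotient:
  fixes K\<^sub>T K\<^sub>S :: "complex \<Rightarrow> complex \<Rightarrow> complex ^ 'n ^ 'n"
  assumes KT: "bounded_kernel_on (ball c r) K\<^sub>T" and KS: "bounded_kernel_on (ball c r) K\<^sub>S"
    and \<Psi>: "mat_holomorphic_on \<Psi> (ball c r)" "\<And>w. w \<in> ball c r \<Longrightarrow> invertible (\<Psi> w)"
    and wirt: "\<And>w. w \<in> ball c r \<Longrightarrow> mat_wirtinger_deriv
        (\<lambda>w. matrix_inv (K\<^sub>T w w) ** matrix_inv (\<Psi> w) ** K\<^sub>S w w) w = 0"
  shows "mat_holomorphic_on (\<lambda>w. cadj (matrix_inv (K\<^sub>T w w) ** matrix_inv (\<Psi> w) ** K\<^sub>S w w)) (ball c r)"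
  unfolding mat_holomorphic_on_def
proof (intro allI holomorphic_onI)
  fix i j w assume w: "w \<in> ball c r"
  let ?A = "\<lambda>w. matrix_inv (K\<^sub>T w w) ** matrix_inv (\<Psi> w) ** K\<^sub>S w w"
  have inv: "invertible (K\<^sub>T w w)" if "w \<in> ball c r" for w
    using bounded_kernel_on_pos_def[OF KT that] by (rule pos_def_imp_invertible)
  have d\<Psi>: "(\<lambda>w. \<Psi> w $ i $ j) differentiable (at w)" for i j
  proof -
    have "(\<lambda>w. \<Psi> w $ i $ j) holomorphic_on ball c r"
      using \<Psi>(1) unfolding mat_holomorphic_on_def by blast
    then show ?thesis
      using w field_differentiable_imp_differentiable holomorphic_on_imp_differentiable_at open_ball
      by blast
  qed
  have "(\<lambda>w. ?A w $ j $ i) differentiable (at w)"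
  proof (rule differentiable_matrix_mult, rule differentiable_matrix_mult)
    show "(\<lambda>w. matrix_inv (K\<^sub>T w w) $ i $ j) differentiable (at w)" for i j
      by (rule differentiable_matrix_inv[OF bounded_kernel_on_diagonal_differentiable[OF KT w]
            open_ball w inv])
    show "(\<lambda>w. matrix_inv (\<Psi> w) $ i $ j) differentiable (at w)" for i j
      by (rule differentiable_matrix_inv[OF d\<Psi> open_ball w \<Psi>(2)])
    show "(\<lambda>w. K\<^sub>S w w $ i $ j) differentiable (at w)" for i j
      by (rule bounded_kernel_on_diagonal_differentiable[OF KS w])
  qed
  moreover have "wirtinger_deriv (\<lambda>w. ?A w $ j $ i) w = 0"
  proof -
    have "mat_wirtinger_deriv ?A w $ j $ i = 0" using wirt[OF w] by simp
    then show ?thesis unfolding mat_wirtinger_deriv_def by simp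
  qed
  ultimately have "(\<lambda>w. cnj (?A w $ j $ i)) field_differentiable (at w)"
    by (rule wirtinger_deriv_zero_imp_antiholomorphic)
  then show "(\<lambda>w. cadj (?A w) $ i $ j) field_differentiable (at w within ball c r)"
    unfolding cadj_nth by (rule field_differentiable_at_within)
qed

text \<open>
Both sides are holomorphic in \<open>z\<close> and antiholomorphic in \<open>w\<close>. Holomorphy of \<open>\<Psi>\<close> and \<open>\<Phi>\<close> up to the closed
disc provides the bound that the scalar polarization principle asks for.
\<close>

lemma kernel_polarization:
  fixes K\<^sub>T K\<^sub>S :: "complex \<Rightarrow> complex \<Rightarrow> complex ^ 'n ^ 'n"
  assumes KT: "bounded_kernel_on (ball c r) K\<^sub>T" and KS: "bounded_kernel_on (ball c r) K\<^sub>S"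
    and \<Psi>: "mat_holomorphic_on \<Psi> (cball c r)" and \<Phi>: "mat_holomorphic_on \<Phi> (cball c r)"
    and diag: "\<And>w. w \<in> ball c r \<Longrightarrow> \<Psi> w ** K\<^sub>T w w ** cadj (\<Phi> w) = K\<^sub>S w w"
    and zw: "z \<in> ball c r" "w \<in> ball c r"
  shows "\<Psi> z ** K\<^sub>T z w ** cadj (\<Phi> w) = K\<^sub>S z w"
proof -
  define L where "L z w = \<Psi> z ** K\<^sub>T z w ** cadj (\<Phi> w)" for z w
  have cad: "cadj (L z w) = \<Phi> w ** K\<^sub>T w z ** cadj (\<Psi> z)" if "z \<in> ball c r" "w \<in> ball c r" for z w
    using bounded_kernel_on_hermitian[OF KT that] by (simp add: L_def cadj_mult matrix_mul_assoc)
  note sub = mat_holomorphic_on_subset[OF _ ball_subset_cball]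
  have hT: "mat_holomorphic_on (\<lambda>z. K\<^sub>T z w) (ball c r)" if "w \<in> ball c r" for w
    using bounded_kernel_on_holomorphic[OF KT that] .
  have hS: "mat_holomorphic_on (\<lambda>z. K\<^sub>S z w) (ball c r)" if "w \<in> ball c r" for w
    using bounded_kernel_on_holomorphic[OF KS that] .
  obtain NT where NT: "\<And>z w i j. z \<in> ball c r \<Longrightarrow> w \<in> ball c r \<Longrightarrow> norm (K\<^sub>T z w $ i $ j) \<le> NT"
    using bounded_kernel_on_bound[OF KT] by blast
  obtain NS where NS: "\<And>z w i j. z \<in> ball c r \<Longrightarrow> w \<in> ball c r \<Longrightarrow> norm (K\<^sub>S z w $ i $ j) \<le> NS"
    using bounded_kernel_on_bound[OF KS] by blast
  obtain N1 where N1: "\<And>z i j. z \<in> cball c r \<Longrightarrow> norm (\<Psi> z $ i $ j) \<le> N1"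
    using mat_holomorphic_bounded[OF \<Psi> compact_cball order_refl] by metis
  obtain N2 where N2: "\<And>z i j. z \<in> cball c r \<Longrightarrow> norm (\<Phi> z $ i $ j) \<le> N2"
    using mat_holomorphic_bounded[OF \<Phi> compact_cball order_refl] by metis
  define n where "n = real CARD('n)"
  have "L z w $ i $ j - K\<^sub>S z w $ i $ j = 0" for i j
  proof (rule sesquiholomorphic_diagonal_zero[of c r "\<lambda>z w. L z w $ i $ j - K\<^sub>S z w $ i $ j"])
    show "(\<lambda>z. L z w $ i $ j - K\<^sub>S z w $ i $ j) holomorphic_on ball c r" if w: "w \<in> ball c r" for w
    proof -
      have "mat_holomorphic_on (\<lambda>z. L z w) (ball c r)"
        unfolding L_def by (intro mat_holomorphic_on_mult sub[OF \<Psi>] hT w mat_holomorphic_on_const)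
      then show ?thesis using hS[OF w] unfolding mat_holomorphic_on_def
        by (intro holomorphic_on_diff) blast+
    qed
    show "(\<lambda>w. cnj (L z w $ i $ j - K\<^sub>S z w $ i $ j)) holomorphic_on ball c r" if z: "z \<in> ball c r" for z
    proof -
      have "mat_holomorphic_on (\<lambda>w. \<Phi> w ** K\<^sub>T w z ** cadj (\<Psi> z)) (ball c r)"
        by (intro mat_holomorphic_on_mult sub[OF \<Phi>] hT z mat_holomorphic_on_const)
      then have "(\<lambda>w. (\<Phi> w ** K\<^sub>T w z ** cadj (\<Psi> z)) $ j $ i - cnj (K\<^sub>S z w $ i $ j)) holomorphic_on ball c r"
        using bounded_kernel_on_antiholomorphic[OF KS z] unfolding mat_holomorphic_on_def
        by (intro holomorphic_on_diff) blast+
      moreover have "(\<Phi> w ** K\<^sub>T w z ** cadj (\<Psi> z)) $ j $ i - cnj (K\<^sub>S z w $ i $ j)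
          = cnj (L z w $ i $ j - K\<^sub>S z w $ i $ j)" if w: "w \<in> ball c r" for w
        by (simp flip: cad[OF z w])
      ultimately show ?thesis by (rule holomorphic_transform)
    qed
    show "norm (L z w $ i $ j - K\<^sub>S z w $ i $ j) \<le> n * (n * (N1 * NT) * N2) + NS"
      if z: "z \<in> ball c r" and w: "w \<in> ball c r" for z w
    proof -
      have "norm (L z w $ i $ j) \<le> n * (n * (N1 * NT) * N2)"
        unfolding L_def n_def
      proof (rule matrix_mult_entry_bound, rule matrix_mult_entry_bound)
        show "norm (\<Psi> z $ i $ j) \<le> N1" for i j using z by (intro N1) simp
        show "norm (K\<^sub>T z w $ i $ j) \<le> NT" for i j using z w by (rule NT)
        show "norm (cadj (\<Phi> w) $ i $ j) \<le> N2" for i j using N2[of w j i] w by simp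
      qed
      then show ?thesis
        using NS[OF z w, of i j] norm_triangle_ineq4[of "L z w $ i $ j" "K\<^sub>S z w $ i $ j"] by linarith
    qed
    show "L w w $ i $ j - K\<^sub>S w w $ i $ j = 0" if "w \<in> ball c r" for w
      using diag[OF that] by (simp add: L_def)
  qed (fact zw)+
  then have "L z w = K\<^sub>S z w" by (simp only: vec_eq_iff right_minus_eq) blast
  then show ?thesis unfolding L_def .
qed

lemma bounded_kernel_on_subset:
  assumes K: "bounded_kernel_on B K" and sub: "B' \<subseteq> B" shows "bounded_kernel_on B' K"
  unfolding bounded_kernel_on_def
proof (intro conjI ballI)
  show "mat_holomorphic_on (\<lambda>z. K z w) B'" if "w \<in> B'" for w
    using mat_holomorphic_on_subset[OF bounded_kernel_on_holomorphic[OF K] sub] that sub by blast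
  show "cadj (K z w) = K w z" if "z \<in> B'" "w \<in> B'" for z w
    using bounded_kernel_on_hermitian[OF K] that sub by blast
  show "pos_def (K w w)" if "w \<in> B'" for w
    using bounded_kernel_on_pos_def[OF K] that sub by blast
  show "\<exists>N. \<forall>z\<in>B'. \<forall>w\<in>B'. \<forall>i j. norm (K z w $ i $ j) \<le> N"
    using bounded_kernel_on_bound[OF K] sub by blast
qed

text \<open>
The local heart of the matter: the diagonal condition, which involves two a priori unrelated holomorphic factors
\<open>\<Psi>\<close> and \<open>\<Phi>\<close>, is turned into a factorization with a single factor \<open>G\<close>, which is \<open>\<Psi>\<close> corrected by a square
root of \<open>C = \<Psi>\<^sup>-\<^sup>1 \<Phi>\<close>. Since one and the same real polynomial \<open>p\<close> produces the square root at every point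
near \<open>c\<close>, the factor \<open>p(C)\<close> can be moved across the kernel just like \<open>C\<close>: of the two factors in
\<open>C(z) = p(C(z))\<^sup>2\<close> one stays on the left and the other becomes \<open>p(C(w))\<^sup>*\<close> on the right.
\<close>

proposition kernel_factorization:
  fixes K\<^sub>T K\<^sub>S :: "complex \<Rightarrow> complex \<Rightarrow> complex ^ 'n ^ 'n"
  assumes r: "0 < r"
    and KT: "bounded_kernel_on (ball c r) K\<^sub>T" and KS: "bounded_kernel_on (ball c r) K\<^sub>S"
    and \<Psi>: "mat_holomorphic_on \<Psi> (ball c r)" and inv\<Psi>: "\<And>w. w \<in> ball c r \<Longrightarrow> invertible (\<Psi> w)"
    and wirt: "\<And>w. w \<in> ball c r \<Longrightarrow> mat_wirtinger_deriv
        (\<lambda>w. matrix_inv (K\<^sub>T w w) ** matrix_inv (\<Psi> w) ** K\<^sub>S w w) w = 0"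
  shows "\<exists>s G. 0 < s \<and> s \<le> r \<and> (\<forall>z\<in>ball c s. invertible (G z)) \<and>
    (\<forall>z\<in>ball c s. \<forall>w\<in>ball c s. K\<^sub>S z w = G z ** K\<^sub>T z w ** cadj (G w))"
proof -
  define \<Phi> where "\<Phi> w = cadj (matrix_inv (K\<^sub>T w w) ** matrix_inv (\<Psi> w) ** K\<^sub>S w w)" for w
  have hol\<Phi>: "mat_holomorphic_on \<Phi> (ball c r)"
    unfolding \<Phi>_def by (rule antiholomorphic_quotient[OF KT KS \<Psi> inv\<Psi> wirt])
  have diag: "\<Psi> w ** K\<^sub>T w w ** cadj (\<Phi> w) = K\<^sub>S w w" if w: "w \<in> ball c r" for w
  proof -
    have iT: "invertible (K\<^sub>T w w)"
      using bounded_kernel_on_pos_def[OF KT w] by (rule pos_def_imp_invertible)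
    have "\<Psi> w ** K\<^sub>T w w ** cadj (\<Phi> w) =
        \<Psi> w ** (K\<^sub>T w w ** matrix_inv (K\<^sub>T w w)) ** matrix_inv (\<Psi> w) ** K\<^sub>S w w"
      by (simp only: \<Phi>_def cadj_cadj matrix_mul_assoc)
    then show ?thesis
      by (simp only: matrix_inv_right[OF iT] matrix_inv_right[OF inv\<Psi>[OF w]] matrix_mul_rid matrix_mul_lid)
  qed
  define B where "B = ball c (r / 2)"
  have sub: "cball c (r / 2) \<subseteq> ball c r" "B \<subseteq> ball c r" using r by (auto simp: B_def)
  have cB: "c \<in> B" using r by (simp add: B_def)
  have I: "\<Psi> z ** K\<^sub>T z w ** cadj (\<Phi> w) = K\<^sub>S z w" if "z \<in> B" "w \<in> B" for z w
  proof (rule kernel_polarization[where r = "r / 2" and c = c])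
    show "bounded_kernel_on (ball c (r / 2)) K\<^sub>T" "bounded_kernel_on (ball c (r / 2)) K\<^sub>S"
      using bounded_kernel_on_subset KT KS sub(2) unfolding B_def by blast+
    show "mat_holomorphic_on \<Psi> (cball c (r / 2))" "mat_holomorphic_on \<Phi> (cball c (r / 2))"
      using mat_holomorphic_on_subset \<Psi> hol\<Phi> sub(1) by blast+
    show "\<Psi> w ** K\<^sub>T w w ** cadj (\<Phi> w) = K\<^sub>S w w" if "w \<in> ball c (r / 2)" for w
      using diag sub(2) that unfolding B_def by blast
  qed (use that in \<open>simp_all add: B_def\<close>)
  \<comment> \<open>The adjoint of \<open>I\<close>: both kernels are Hermitian, so the two factors trade places.\<close>
  have II: "\<Phi> z ** K\<^sub>T z w ** cadj (\<Psi> w) = K\<^sub>S z w" if zw: "z \<in> B" "w \<in> B" for z w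
  proof -
    have zw': "z \<in> ball c r" "w \<in> ball c r" using zw sub by auto
    have "K\<^sub>S z w = cadj (K\<^sub>S w z)" using bounded_kernel_on_hermitian[OF KS zw'(2,1)] by simp
    also have "\<dots> = cadj (\<Psi> w ** K\<^sub>T w z ** cadj (\<Phi> z))" by (simp only: I[OF zw(2,1)])
    also have "\<dots> = \<Phi> z ** cadj (K\<^sub>T w z) ** cadj (\<Psi> w)"
      by (simp only: cadj_mult cadj_cadj matrix_mul_assoc)
    also have "cadj (K\<^sub>T w z) = K\<^sub>T z w" by (rule bounded_kernel_on_hermitian[OF KT zw'(2,1)])
    finally show ?thesis ..
  qed
  define C where "C z = matrix_inv (\<Psi> z) ** \<Phi> z" for z
  have \<Psi>C: "\<Psi> z ** C z = \<Phi> z" if "z \<in> B" for z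
    using matrix_inv_right[OF inv\<Psi>, of z] that sub by (auto simp add: C_def matrix_mul_assoc)
  have III: "C z ** K\<^sub>T z w = K\<^sub>T z w ** cadj (C w)" if zw: "z \<in> B" "w \<in> B" for z w
  proof (rule matrix_cancel_left, rule inv\<Psi>)
    show "z \<in> ball c r" using zw sub by blast
    have iw: "invertible (cadj (\<Psi> w))" using inv\<Psi> invertible_cadj zw sub by blast
    show "\<Psi> z ** (C z ** K\<^sub>T z w) = \<Psi> z ** (K\<^sub>T z w ** cadj (C w))"
    proof (rule matrix_cancel_right[OF iw])
      have "\<Psi> z ** (C z ** K\<^sub>T z w) ** cadj (\<Psi> w) = (\<Psi> z ** C z) ** K\<^sub>T z w ** cadj (\<Psi> w)"
        by (simp only: matrix_mul_assoc)
      also have "\<dots> = K\<^sub>S z w" by (simp only: \<Psi>C[OF zw(1)] II[OF zw])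
      also have "\<dots> = \<Psi> z ** K\<^sub>T z w ** cadj (\<Psi> w ** C w)" by (simp only: \<Psi>C[OF zw(2)] I[OF zw])
      also have "\<dots> = \<Psi> z ** (K\<^sub>T z w ** cadj (C w)) ** cadj (\<Psi> w)"
        by (simp only: cadj_mult matrix_mul_assoc)
      finally show "\<Psi> z ** (C z ** K\<^sub>T z w) ** cadj (\<Psi> w) =
          \<Psi> z ** (K\<^sub>T z w ** cadj (C w)) ** cadj (\<Psi> w)" .
    qed
  qed
  \<comment> \<open>At the centre, \<open>III\<close> says that \<open>M\<close> is self-adjoint with respect to \<open>k\<close>; and \<open>k M\<close> is congruent
    to \<open>K\<^sub>S(c, c)\<close>, hence positive.\<close>
  define M where "M = cadj (C c)"
  define k where "k = K\<^sub>T c c"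
  have cr: "c \<in> ball c r" using r by simp
  have kpos: "pos_def k" unfolding k_def by (rule bounded_kernel_on_pos_def[OF KT cr])
  have sa: "k ** M = cadj M ** k" unfolding k_def M_def cadj_cadj by (rule III[OF cB cB, symmetric])
  have kMpos: "pos_def (k ** M)"
  proof -
    let ?P = "matrix_inv (\<Psi> c)"
    have "?P ** \<Psi> c = mat 1" using matrix_inv_left[OF inv\<Psi>[OF cr]] .
    then have "k ** M = (?P ** \<Psi> c) ** (K\<^sub>T c c ** cadj (\<Phi> c)) ** cadj ?P"
      by (simp only: k_def M_def C_def cadj_mult matrix_mul_assoc matrix_mul_lid)
    also have "\<dots> = ?P ** (\<Psi> c ** K\<^sub>T c c ** cadj (\<Phi> c)) ** cadj ?P"
      by (simp only: matrix_mul_assoc)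
    also have "\<dots> = ?P ** K\<^sub>S c c ** cadj ?P" by (simp only: diag[OF cr])
    finally have "k ** M = ?P ** K\<^sub>S c c ** cadj ?P" .
    then show ?thesis
      using pos_def_congruence[OF bounded_kernel_on_pos_def[OF KS cr] invertible_matrix_inv[OF inv\<Psi>[OF cr]]]
      by simp
  qed
  obtain p :: "real poly"
    where p: "poly_mat M (map_poly of_real p) ** poly_mat M (map_poly of_real p) = M"
    using selfadjoint_positive_polynomial_sqrt[OF sa kpos kMpos] by blast
  let ?p = "map_poly complex_of_real p"
  obtain s where s: "0 < s" "s \<le> r / 2" "\<And>z. z \<in> ball c s \<Longrightarrow> invertible (K\<^sub>T z c)"
  proof -
    have "(\<lambda>z. det (K\<^sub>T z c)) holomorphic_on ball c r"
      by (rule holomorphic_on_det[OF bounded_kernel_on_holomorphic[OF KT cr]])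
    then have "continuous_on (ball c r) (\<lambda>z. det (K\<^sub>T z c))" by (rule holomorphic_on_imp_continuous_on)
    then have "continuous (at c) (\<lambda>z. det (K\<^sub>T z c))"
      using cr by (simp add: continuous_on_eq_continuous_at)
    moreover have "det (K\<^sub>T c c) \<noteq> 0"
      using pos_def_imp_invertible[OF kpos] invertible_det_nz unfolding k_def by blast
    ultimately obtain e where e: "e > 0" "\<And>z. dist c z < e \<Longrightarrow> det (K\<^sub>T z c) \<noteq> 0"
      using continuous_at_avoid[of c "\<lambda>z. det (K\<^sub>T z c)" 0] by blast
    show ?thesis
      by (rule that[of "min e (r / 2)"]) (use e r in \<open>auto simp: invertible_det_nz\<close>)
  qed
  \<comment> \<open>By \<open>III\<close> with \<open>w = c\<close>, \<open>C(z)\<close> is similar to \<open>M\<close> as soon as \<open>K\<^sub>T(z, c)\<close> is invertible.\<close>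
  have sB: "ball c s \<subseteq> B" using s(2) unfolding B_def by (rule subset_ball)
  have sqrtC: "poly_mat (C z) ?p ** poly_mat (C z) ?p = C z" if z: "z \<in> ball c s" for z
  proof (rule matrix_cancel_right[OF s(3)[OF z]])
    let ?K = "K\<^sub>T z c"
    have CK: "C z ** ?K = ?K ** M" unfolding M_def using III cB z sB by blast
    have "poly_mat (C z) ?p ** poly_mat (C z) ?p ** ?K = poly_mat (C z) ?p ** (poly_mat (C z) ?p ** ?K)"
      by (simp only: matrix_mul_assoc)
    also have "\<dots> = (poly_mat (C z) ?p ** ?K) ** poly_mat M ?p"
      by (simp only: poly_mat_intertwine[OF CK] matrix_mul_assoc)
    also have "\<dots> = ?K ** (poly_mat M ?p ** poly_mat M ?p)"
      by (simp only: poly_mat_intertwine[OF CK] matrix_mul_assoc)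
    finally show "poly_mat (C z) ?p ** poly_mat (C z) ?p ** ?K = C z ** ?K" by (simp only: p CK)
  qed
  define G where "G z = \<Psi> z ** poly_mat (C z) ?p" for z
  have "invertible (G z)" if z: "z \<in> ball c s" for z
  proof -
    have zr: "z \<in> B" "z \<in> ball c r" using subsetD[OF sB z] subsetD[OF sub(2)] by blast+
    have "invertible (K\<^sub>S z z)" using bounded_kernel_on_pos_def[OF KS zr(2)] by (rule pos_def_imp_invertible)
    then have "invertible (\<Phi> z ** (K\<^sub>T z z ** cadj (\<Psi> z)))"
      by (simp only: II[OF zr(1) zr(1)] matrix_mul_assoc)
    then have "invertible (\<Psi> z ** C z)" by (simp only: \<Psi>C[OF zr(1)] invertible_factors(1))
    then have "invertible (C z)" by (rule invertible_factors(2))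
    then have "invertible (poly_mat (C z) ?p)"
      using sqrtC[OF z] invertible_factors(1) by metis
    then show ?thesis unfolding G_def using inv\<Psi>[OF zr(2)] by (simp add: invertible_mult)
  qed
  moreover have "K\<^sub>S z w = G z ** K\<^sub>T z w ** cadj (G w)" if z: "z \<in> ball c s" and w: "w \<in> ball c s" for z w
  proof -
    let ?K = "K\<^sub>T z w"
    have zw: "z \<in> B" "w \<in> B" using z w sB by auto
    have "G z ** ?K ** cadj (G w) = \<Psi> z ** poly_mat (C z) ?p ** (?K ** poly_mat (cadj (C w)) ?p) ** cadj (\<Psi> w)"
      by (simp only: G_def cadj_mult poly_mat_cadj matrix_mul_assoc)
    also have "\<dots> = \<Psi> z ** (poly_mat (C z) ?p ** poly_mat (C z) ?p) ** ?K ** cadj (\<Psi> w)"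
      by (simp only: poly_mat_intertwine[OF III[OF zw], symmetric] matrix_mul_assoc)
    also have "\<dots> = K\<^sub>S z w" by (simp only: sqrtC[OF z] \<Psi>C[OF zw(1)] II[OF zw])
    finally show ?thesis ..
  qed
  ultimately show ?thesis using s(1,2) r by (intro exI[of _ s] exI[of _ G]) auto
qed

section \<open>Reproducing kernel spaces of holomorphic functions\<close>

locale rkhs =
  fixes D :: "complex set"
    and H :: "(complex \<Rightarrow> complex ^ 'n) set"
    and ip :: "(complex \<Rightarrow> complex ^ 'n) \<Rightarrow> (complex \<Rightarrow> complex ^ 'n) \<Rightarrow> complex"
    and K :: "complex \<Rightarrow> complex \<Rightarrow> complex ^ 'n ^ 'n"
  assumes analytic_rkhs: "analytic_rkhs D H ip K" and open_domain: "open D"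
begin

sublocale complex_hilbert_space H ip
  using analytic_rkhs unfolding analytic_rkhs_def by blast

lemma holomorphic_elem: "f \<in> H \<Longrightarrow> (\<lambda>z. f z $ i) holomorphic_on D"
  using analytic_rkhs unfolding analytic_rkhs_def vec_holomorphic_on_def by blast

lemma zero_outside: "f \<in> H \<Longrightarrow> z \<notin> D \<Longrightarrow> f z = 0"
  using analytic_rkhs unfolding analytic_rkhs_def by blast

lemma kernel_holomorphic: "w \<in> D \<Longrightarrow> mat_holomorphic_on (\<lambda>z. K z w) D"
  using analytic_rkhs unfolding analytic_rkhs_def by blast

abbreviation ksec where "ksec \<equiv> kernel_section D K"

lemma ksec_in [simp]: "w \<in> D \<Longrightarrow> ksec w \<xi> \<in> H"
  using analytic_rkhs unfolding analytic_rkhs_def by blast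

lemma reproducing: "w \<in> D \<Longrightarrow> f \<in> H \<Longrightarrow> ip f (ksec w \<xi>) = cvec_inner (f w) \<xi>"
  using analytic_rkhs unfolding analytic_rkhs_def by blast

lemma ksec_apply [simp]: "z \<in> D \<Longrightarrow> ksec w \<xi> z = K z w *v \<xi>"
  by (simp add: kernel_section_def)

lemma ksec_add: "ksec w (\<xi> + \<eta>) = ksec w \<xi> + ksec w \<eta>"
  by (auto simp: kernel_section_def fun_eq_iff matrix_vector_right_distrib)

lemma ksec_scale: "ksec w (a *s \<xi>) = a *\<^sub>C ksec w \<xi>"
  by (auto simp: kernel_section_def fun_eq_iff scaleC_fun_def scaleC_vec_eq matrix_vector_mult_smult)

lemma ip_ksec: "z \<in> D \<Longrightarrow> w \<in> D \<Longrightarrow> ip (ksec w \<xi>) (ksec z \<eta>) = cvec_inner (K z w *v \<xi>) \<eta>"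
  by (simp add: reproducing)

lemma coordinate: "w \<in> D \<Longrightarrow> f \<in> H \<Longrightarrow> f w $ i = ip f (ksec w (axis i 1))"
  by (simp add: reproducing)

lemma kernel_hermitian:
  assumes "z \<in> D" "w \<in> D" shows "cadj (K z w) = K w z"
proof -
  have "cnj (K z w $ j $ i) = K w z $ i $ j" for i j
  proof -
    have "K w z $ i $ j = ip (ksec z (axis j 1)) (ksec w (axis i 1))"
      using assms by (simp add: reproducing)
    also have "\<dots> = cnj (ip (ksec w (axis i 1)) (ksec z (axis j 1)))"
      using assms by (intro ip_cnj) auto
    also have "\<dots> = cnj (K z w $ j $ i)" using assms by (simp add: reproducing)
    finally show ?thesis ..
  qed
  then show ?thesis by (simp add: vec_eq_iff)
qed

text \<open>
The quadratic form of \<open>K(w, w)\<close> is the squared norm of the kernel section at \<open>w\<close>.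
\<close>

lemma kernel_pos_def:
  assumes w: "w \<in> D" and inv: "invertible (K w w)" shows "pos_def (K w w)"
  unfolding pos_def_def
proof (intro allI impI)
  fix x :: "complex ^ 'n" assume x: "x \<noteq> 0"
  have "ksec w x \<noteq> 0"
  proof
    assume "ksec w x = 0"
    then have "ksec w x w = 0" by simp
    then have "K w w *v x = 0" using w by simp
    then have "(matrix_inv (K w w) ** K w w) *v x = 0"
      by (simp only: matrix_vector_mul_assoc[symmetric] matrix_vector_mult_0_right)
    then show False using x by (simp add: matrix_inv_left[OF inv])
  qed
  then have "0 < (hnorm ip (ksec w x))\<^sup>2" using w hnorm_eq_0 by simp
  moreover have "cvec_inner (K w w *v x) x = of_real ((hnorm ip (ksec w x))\<^sup>2)"
    using w ip_ksec[of w w x x] ip_self[of "ksec w x"] by simp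
  ultimately show "cvec_inner (K w w *v x) x \<in> \<real> \<and> 0 < Re (cvec_inner (K w w *v x) x)"
    by simp
qed

text \<open>
The identity theorem. It is what makes a Hilbert space of holomorphic functions recoverable from an arbitrarily
small piece of the domain.
\<close>

lemma elem_eqI:
  assumes f: "f \<in> H" and g: "g \<in> H" and D: "connected D"
    and \<Lambda>: "open \<Lambda>" "\<Lambda> \<noteq> {}" "\<Lambda> \<subseteq> D" and eq: "\<And>z. z \<in> \<Lambda> \<Longrightarrow> f z = g z"
  shows "f = g"
proof
  fix z
  show "f z = g z"
  proof (cases "z \<in> D")
    case True
    have "f z $ i = g z $ i" for i
      by (rule analytic_continuation_open[OF \<Lambda>(1) open_domain \<Lambda>(2) D \<Lambda>(3)
            holomorphic_elem[OF f] holomorphic_elem[OF g] _ True]) (simp add: eq)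
    then show ?thesis by (simp add: vec_eq_iff)
  qed (simp add: zero_outside f g)
qed

lemma tendsto_coordinate:
  assumes "\<And>k. X k \<in> H" "f \<in> H" "(\<lambda>k. hnorm ip (X k - f)) \<longlonglongrightarrow> 0" "w \<in> D"
  shows "(\<lambda>k. X k w $ i) \<longlonglongrightarrow> f w $ i"
  using tendsto_ip_left[OF assms(1,2) ksec_in[OF assms(4)] assms(3), of "axis i 1"] assms
  by (simp add: reproducing)

text \<open>
If \<open>K(w, w) x = 0\<close>, then the section of \<open>x\<close> has norm \<open>0\<close>. A nonzero such \<open>x\<close> with \<open>x\<^sub>i \<noteq> 0\<close> would make
the \<open>i\<close>-th coordinate section a combination of the others, so that the sections at \<open>w\<close> could not span an
\<open>n\<close>-dimensional space.
\<close>

lemma invertible_diagonal_of_dim: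
  assumes w: "w \<in> D" and dim: "cvs.dim (range (ksec w)) = CARD('n)"
  shows "invertible (K w w)"
proof (rule invertible_injI, rule ccontr)
  fix x assume Kx: "K w w *v x = 0" and x: "x \<noteq> 0"
  have "ip (ksec w x) (ksec w x) = 0" using w Kx by (simp add: ip_ksec)
  then have s0: "ksec w x = 0" using w ip_definite by simp
  obtain i where i: "x $ i \<noteq> 0" using x by (auto simp: vec_eq_iff)
  let ?W = "(\<lambda>j. ksec w (axis j 1)) ` (UNIV - {i})"
  have "ksec w \<xi> \<in> cvs.span ?W" for \<xi>
  proof -
    \<comment> \<open>Adding a multiple of \<open>x\<close> does not change the section and removes the \<open>i\<close>-th coordinate.\<close>
    define \<eta> where "\<eta> = \<xi> + (- \<xi> $ i / x $ i) *s x"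
    have "\<eta> $ i = 0" using i by (simp add: \<eta>_def)
    then have e: "\<eta> = (\<Sum>j\<in>UNIV - {i}. \<eta> $ j *s axis j 1)"
      by (subst basis_expansion[symmetric]) (simp add: sum.remove[of UNIV i])
    have in_span: "ksec w (\<Sum>j\<in>A. \<eta> $ j *s axis j 1) \<in> cvs.span ?W" if "A \<subseteq> UNIV - {i}" for A
      using finite_subset[OF that finite] that
    proof (induction A)
      case empty
      have "ksec w 0 = 0" by (auto simp: kernel_section_def fun_eq_iff)
      then show ?case using cvs.span_zero[of ?W] by (simp only: sum.empty)
    next
      case (insert a A)
      have "ksec w (\<Sum>j\<in>insert a A. \<eta> $ j *s axis j 1) =
          \<eta> $ a *\<^sub>C ksec w (axis a 1) + ksec w (\<Sum>j\<in>A. \<eta> $ j *s axis j 1)"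
        by (simp only: sum.insert[OF insert.hyps] ksec_add ksec_scale)
      also have "\<dots> \<in> cvs.span ?W"
      proof (rule cvs.span_add)
        show "\<eta> $ a *\<^sub>C ksec w (axis a 1) \<in> cvs.span ?W"
          using insert.prems by (intro cvs.span_scale cvs.span_base) blast
        show "ksec w (\<Sum>j\<in>A. \<eta> $ j *s axis j 1) \<in> cvs.span ?W"
          using insert.prems by (intro insert.IH) blast
      qed
      finally show ?case .
    qed
    have "ksec w \<eta> \<in> cvs.span ?W" using in_span[OF order_refl] by (simp only: e[symmetric])
    moreover have "ksec w \<eta> = ksec w \<xi>"
      unfolding \<eta>_def ksec_add ksec_scale s0 by simp
    ultimately show ?thesis by simp
  qed
  then have "range (ksec w) \<subseteq> cvs.span ?W" by blast
  then have "cvs.dim (range (ksec w)) \<le> card ?W" by (rule cvs.dim_le_card) simp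
  also have "\<dots> \<le> card (UNIV - {i})" by (rule card_image_le) simp
  also have "\<dots> < CARD('n)" by (rule psubset_card_mono) auto
  finally show False using dim by simp
qed

end

text \<open>
The uniform boundedness principle in the domain: the sets where all members of the family are bounded by
\<open>n\<close> are closed and cover a closed disc, so one of them has interior points by Baire's theorem. The resulting
ball cannot be prescribed, only its location inside \<open>\<Lambda>\<close>.
\<close>

lemma uniformly_bounded_on_ball:
  fixes \<F> :: "(complex \<Rightarrow> complex) set"
  assumes \<Lambda>: "open \<Lambda>" "\<Lambda> \<noteq> {}" and cont: "\<And>f. f \<in> \<F> \<Longrightarrow> continuous_on \<Lambda> f"
    and ptw: "\<And>w. w \<in> \<Lambda> \<Longrightarrow> \<exists>N. \<forall>f\<in>\<F>. norm (f w) \<le> N"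
  shows "\<exists>c r N. 0 < r \<and> ball c r \<subseteq> \<Lambda> \<and> (\<forall>w\<in>ball c r. \<forall>f\<in>\<F>. norm (f w) \<le> N)"
proof -
  obtain a where "a \<in> \<Lambda>" using \<Lambda> by blast
  then obtain e where e: "e > 0" "cball a e \<subseteq> \<Lambda>" using \<Lambda>(1) open_contains_cball by blast
  define E where "E n = {w \<in> cball a e. \<forall>f\<in>\<F>. norm (f w) \<le> real n}" for n
  have closed: "closed (E n)" for n
  proof (cases "\<F> = {}")
    case True
    then have "E n = cball a e" unfolding E_def by blast
    then show ?thesis using closed_cball by (simp only:)
  next
    case False
    have "E n = (\<Inter>f\<in>\<F>. {w \<in> cball a e. norm (f w) \<le> real n})"
      using False by (auto simp: E_def)
    moreover have "closed {w \<in> cball a e. norm (f w) \<le> real n}" if "f \<in> \<F>" for f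
    proof -
      have "continuous_on (cball a e) (\<lambda>w. norm (f w))"
        using cont[OF that] e(2) continuous_on_subset continuous_on_norm by blast
      then have "closed (cball a e \<inter> (\<lambda>w. norm (f w)) -` {..real n})"
        by (rule continuous_closed_preimage) auto
      moreover have "cball a e \<inter> (\<lambda>w. norm (f w)) -` {..real n} = {w \<in> cball a e. norm (f w) \<le> real n}"
        by auto
      ultimately show ?thesis by simp
    qed
    ultimately show ?thesis by auto
  qed
  have "\<exists>n. interior (E n) \<noteq> {}"
  proof (rule ccontr)
    assume "\<not> ?thesis"
    then have dense: "closure (- E n) = UNIV" for n by (simp add: closure_complement)
    have "UNIV \<subseteq> closure (\<Inter>(range (\<lambda>n. - E n)))"
    proof (rule Baire)
      show "openin (top_of_set UNIV) T \<and> UNIV \<subseteq> closure T" if "T \<in> range (\<lambda>n. - E n)" for T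
        using that closed dense by auto
    qed auto
    also have "\<Inter>(range (\<lambda>n. - E n)) \<subseteq> - cball a e"
    proof
      fix w assume w: "w \<in> \<Inter>(range (\<lambda>n. - E n))"
      show "w \<in> - cball a e"
      proof
        assume wc: "w \<in> cball a e"
        then obtain N where N: "\<And>f. f \<in> \<F> \<Longrightarrow> norm (f w) \<le> N" using ptw e by blast
        obtain n where "N \<le> real n" using real_arch_simple by blast
        then have "w \<in> E n" unfolding E_def using wc N order_trans by blast
        then show False using w by blast
      qed
    qed
    finally have "UNIV \<subseteq> closure (- cball a e)" using closure_mono by blast
    then have "UNIV \<subseteq> - interior (cball a e)" by (simp only: closure_complement)
    then have "ball a e = {}" by (simp only: interior_cball) blast
    then show False using e(1) by simp
  qed
  then obtain n x where "x \<in> interior (E n)" by blast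
  then obtain r where r: "r > 0" "ball x r \<subseteq> E n" unfolding mem_interior by blast
  have "ball x r \<subseteq> \<Lambda>" using r e unfolding E_def by blast
  moreover have "\<forall>w\<in>ball x r. \<forall>f\<in>\<F>. norm (f w) \<le> real n" using r unfolding E_def by blast
  ultimately show ?thesis using r(1) by blast
qed

text \<open>
Point evaluations are bounded functionals, so the unit ball of \<open>H\<close> is pointwise bounded and hence uniformly
bounded on some disc, say by \<open>N\<close>. Applied to a coordinate section \<open>s\<close> at \<open>w\<close>, this gives
\<open>\<parallel>s\<parallel>\<^sup>2 = s(w)\<^sub>j \<le> N \<parallel>s\<parallel>\<close>, so \<open>\<parallel>s\<parallel> \<le> N\<close>, and the entries of the kernel are the values of such sections.
\<close>

lemma (in rkhs) kernel_bounded_on_ball: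
  assumes \<Lambda>: "open \<Lambda>" "\<Lambda> \<noteq> {}" "\<Lambda> \<subseteq> D" and inv: "\<And>w. w \<in> D \<Longrightarrow> invertible (K w w)"
  shows "\<exists>c r. 0 < r \<and> ball c r \<subseteq> \<Lambda> \<and> bounded_kernel_on (ball c r) K"
proof -
  define \<F> where "\<F> = {(\<lambda>w. f w $ i) | f i. f \<in> H \<and> hnorm ip f \<le> 1}"
  have "\<exists>c r N. 0 < r \<and> ball c r \<subseteq> \<Lambda> \<and> (\<forall>w\<in>ball c r. \<forall>f\<in>\<F>. norm (f w) \<le> N)"
  proof (rule uniformly_bounded_on_ball[OF \<Lambda>(1,2)])
    show "continuous_on \<Lambda> f" if f: "f \<in> \<F>" for f
    proof -
      obtain g i where "f = (\<lambda>w. g w $ i)" "g \<in> H" using f unfolding \<F>_def by blast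
      then have "f holomorphic_on D" using holomorphic_elem by blast
      then show ?thesis using \<Lambda>(3) holomorphic_on_imp_continuous_on continuous_on_subset by blast
    qed
    show "\<exists>N. \<forall>f\<in>\<F>. norm (f w) \<le> N" if w: "w \<in> \<Lambda>" for w
    proof -
      have wD: "w \<in> D" using w \<Lambda> by blast
      let ?N = "\<Sum>i\<in>UNIV. hnorm ip (ksec w (axis i 1))"
      have "norm (f w $ i) \<le> ?N" if f: "f \<in> H" "hnorm ip f \<le> 1" for f i
      proof -
        have "norm (f w $ i) = cmod (ip f (ksec w (axis i 1)))" using coordinate[OF wD f(1)] by simp
        also have "\<dots> \<le> hnorm ip f * hnorm ip (ksec w (axis i 1))"
          using f wD by (intro cauchy_schwarz) auto
        also have "\<dots> \<le> 1 * hnorm ip (ksec w (axis i 1))"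
          using f wD by (intro mult_right_mono) auto
        also have "\<dots> \<le> ?N"
          using wD member_le_sum[of i UNIV "\<lambda>i. hnorm ip (ksec w (axis i 1))"] by simp
        finally show ?thesis .
      qed
      then show ?thesis unfolding \<F>_def by blast
    qed
  qed
  then obtain c r N where r: "0 < r" "ball c r \<subseteq> \<Lambda>"
    and N0: "\<And>w f. w \<in> ball c r \<Longrightarrow> f \<in> \<F> \<Longrightarrow> norm (f w) \<le> N" by blast
  have sub: "ball c r \<subseteq> D" using r \<Lambda> by blast
  have N: "norm (f w $ i) \<le> N * hnorm ip f" if w: "w \<in> ball c r" and f: "f \<in> H" for w f i
  proof (cases "f = 0")
    case False
    define t where "t = hnorm ip f"
    have t: "t > 0" using False hnorm_eq_0[OF f] hnorm_nonneg[OF f] by (simp add: t_def)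
    let ?g = "complex_of_real (1 / t) *\<^sub>C f"
    have g: "?g \<in> H" using f by simp
    have "ip ?g ?g = complex_of_real (1 / t) * (complex_of_real (1 / t) * ip f f)"
      using f by (simp add: ip_scaleC_left ip_scaleC_right)
    also have "\<dots> = 1" using t ip_self[OF f] by (simp add: t_def power2_eq_square)
    finally have "hnorm ip ?g = 1" by (simp add: hnorm_def)
    then have "(\<lambda>w. ?g w $ i) \<in> \<F>" using g unfolding \<F>_def by force
    then have "norm (?g w $ i) \<le> N" using N0[OF w] by blast
    moreover have "?g w $ i = f w $ i / of_real t"
      by (simp add: scaleC_fun_def scaleC_vec_def scaleC_complex_def)
    ultimately show ?thesis using t by (simp add: norm_divide field_simps t_def)
  qed (use hnorm_eq_0[OF carrier_zero] in simp)
  have bound: "norm (K z w $ i $ j) \<le> N * N" if z: "z \<in> ball c r" and w: "w \<in> ball c r" for z w i j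
  proof -
    let ?s = "ksec w (axis j 1)"
    have zD: "z \<in> D" and wD: "w \<in> D" using z w sub by auto
    have N_nonneg: "0 \<le> N"
    proof -
      have "(\<lambda>w. (0 :: complex \<Rightarrow> complex ^ 'n) w $ i) \<in> \<F>"
        unfolding \<F>_def
      proof (intro CollectI exI conjI)
        have "hnorm ip 0 = 0" using hnorm_eq_0[OF carrier_zero] by blast
        then show "hnorm ip 0 \<le> 1" by linarith
      qed (rule refl, rule carrier_zero)
      then have "norm ((0 :: complex \<Rightarrow> complex ^ 'n) w $ i) \<le> N" using N0[OF w] by blast
      then show ?thesis by simp
    qed
    have "(hnorm ip ?s)\<^sup>2 = Re (?s w $ j)"
      using wD ip_ksec[OF wD wD, of "axis j 1" "axis j 1"] by (simp add: hnorm_sq)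
    also have "\<dots> \<le> norm (?s w $ j)" by (rule complex_Re_le_cmod)
    also have "\<dots> \<le> N * hnorm ip ?s" using w wD by (intro N) auto
    finally have "hnorm ip ?s * hnorm ip ?s \<le> N * hnorm ip ?s" by (simp add: power2_eq_square)
    then have sN: "hnorm ip ?s \<le> N"
      using hnorm_nonneg[OF ksec_in[OF wD, of "axis j 1"]] N_nonneg
      by (cases "hnorm ip ?s = 0") auto
    have "norm (K z w $ i $ j) = norm (?s z $ i)" using zD by simp
    also have "\<dots> \<le> N * hnorm ip ?s" using z wD by (intro N) auto
    also have "\<dots> \<le> N * N" using sN N_nonneg by (rule mult_left_mono)
    finally show ?thesis .
  qed
  have "bounded_kernel_on (ball c r) K"
    unfolding bounded_kernel_on_def
  proof (intro conjI ballI)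
    show "mat_holomorphic_on (\<lambda>z. K z w) (ball c r)" if "w \<in> ball c r" for w
      using mat_holomorphic_on_subset[OF kernel_holomorphic sub] that sub by blast
    show "cadj (K z w) = K w z" if "z \<in> ball c r" "w \<in> ball c r" for z w
      using kernel_hermitian that sub by blast
    show "pos_def (K w w)" if "w \<in> ball c r" for w
      using kernel_pos_def inv that sub by blast
    show "\<exists>N. \<forall>z\<in>ball c r. \<forall>w\<in>ball c r. \<forall>i j. norm (K z w $ i $ j) \<le> N"
      using bound by blast
  qed
  then show ?thesis using r by blast
qed

section \<open>Unitary extension of a local change of frame\<close>

text \<open>
Two spaces on a connected domain whose kernels differ, over a small open set \<open>\<Lambda>\<close>, by a pointwise invertible
change of frame \<open>G\<close>. The aim is to show that multiplication by \<open>G\<close> on \<open>\<Lambda>\<close> is the restriction of a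
unitary operator from \<open>H\<^sub>1\<close> onto \<open>H\<^sub>2\<close>.
\<close>

locale matched_rkhs = dom: rkhs D H\<^sub>1 ip\<^sub>1 K\<^sub>1 + cod: rkhs D H\<^sub>2 ip\<^sub>2 K\<^sub>2
  for D :: "complex set"
    and H\<^sub>1 H\<^sub>2 :: "(complex \<Rightarrow> complex ^ 'n) set"
    and ip\<^sub>1 ip\<^sub>2 :: "(complex \<Rightarrow> complex ^ 'n) \<Rightarrow> (complex \<Rightarrow> complex ^ 'n) \<Rightarrow> complex"
    and K\<^sub>1 K\<^sub>2 :: "complex \<Rightarrow> complex \<Rightarrow> complex ^ 'n ^ 'n" +
  fixes \<Lambda> :: "complex set" and G :: "complex \<Rightarrow> complex ^ 'n ^ 'n"
  assumes conn: "connected D"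
    and \<Lambda>: "open \<Lambda>" "\<Lambda> \<noteq> {}" "\<Lambda> \<subseteq> D"
    and invG: "\<And>z. z \<in> \<Lambda> \<Longrightarrow> invertible (G z)"
    and KG: "\<And>z w. z \<in> \<Lambda> \<Longrightarrow> w \<in> \<Lambda> \<Longrightarrow> K\<^sub>2 z w = G z ** K\<^sub>1 z w ** cadj (G w)"
begin

text \<open>
The graph of the operator to be constructed. It determines \<open>g\<close> from \<open>f\<close> and \<open>f\<close> from \<open>g\<close> by the identity
theorem, but its domain is not yet known to be all of \<open>H\<^sub>1\<close>.
\<close>

definition matched :: "(complex \<Rightarrow> complex ^ 'n) \<Rightarrow> (complex \<Rightarrow> complex ^ 'n) \<Rightarrow> bool" where
  "matched f g \<longleftrightarrow> f \<in> H\<^sub>1 \<and> g \<in> H\<^sub>2 \<and> (\<forall>z\<in>\<Lambda>. g z = G z *v f z)"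

text \<open>
A matched pair that has the correct inner products with every other matched pair. Building isometry into the
relation lets it pass through linear combinations and limits together with the pair.
\<close>

definition partner :: "(complex \<Rightarrow> complex ^ 'n) \<Rightarrow> (complex \<Rightarrow> complex ^ 'n) \<Rightarrow> bool" where
  "partner f g \<longleftrightarrow> matched f g \<and> (\<forall>a b. matched a b \<longrightarrow> ip\<^sub>2 b g = ip\<^sub>1 a f)"

lemma matchedI: "f \<in> H\<^sub>1 \<Longrightarrow> g \<in> H\<^sub>2 \<Longrightarrow> (\<And>z. z \<in> \<Lambda> \<Longrightarrow> g z = G z *v f z) \<Longrightarrow> matched f g"
  unfolding matched_def by blast

lemma matchedD:
  assumes "matched f g"
  shows "f \<in> H\<^sub>1" "g \<in> H\<^sub>2" "z \<in> \<Lambda> \<Longrightarrow> g z = G z *v f z"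
  using assms unfolding matched_def by blast+

lemma partner_matched: "partner f g \<Longrightarrow> matched f g"
  unfolding partner_def by blast

lemma partner_adjoint: "partner f g \<Longrightarrow> matched a b \<Longrightarrow> ip\<^sub>2 b g = ip\<^sub>1 a f"
  unfolding partner_def by blast

lemma partnerI:
  "matched f g \<Longrightarrow> (\<And>a b. matched a b \<Longrightarrow> ip\<^sub>2 b g = ip\<^sub>1 a f) \<Longrightarrow> partner f g"
  unfolding partner_def by blast

lemma matched_unique_right: "matched f g \<Longrightarrow> matched f g' \<Longrightarrow> g = g'"
  by (rule cod.elem_eqI[OF _ _ conn \<Lambda>]) (simp_all add: matchedD)

lemma matched_unique_left:
  assumes m: "matched f g" "matched f' g" shows "f = f'"
proof (rule dom.elem_eqI[OF matchedD(1)[OF m(1)] matchedD(1)[OF m(2)] conn \<Lambda>])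
  fix z assume z: "z \<in> \<Lambda>"
  have "matrix_inv (G z) *v (G z *v f z) = matrix_inv (G z) *v (G z *v f' z)"
    using matchedD(3)[OF m(1) z] matchedD(3)[OF m(2) z] by simp
  then show "f z = f' z"
    by (simp only: matrix_vector_mul_assoc matrix_inv_left[OF invG[OF z]] matrix_vector_mul_lid)
qed

lemma partner_add:
  assumes p: "partner f g" "partner f' g'" shows "partner (f + f') (g + g')"
proof (rule partnerI)
  note m = partner_matched[OF p(1)] partner_matched[OF p(2)]
  note in1 = matchedD(1)[OF m(1)] matchedD(1)[OF m(2)]
  note in2 = matchedD(2)[OF m(1)] matchedD(2)[OF m(2)]
  show "matched (f + f') (g + g')"
  proof (rule matchedI[OF dom.carrier_add[OF in1] cod.carrier_add[OF in2]])
    show "(g + g') z = G z *v (f + f') z" if "z \<in> \<Lambda>" for z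
      by (simp add: matchedD(3)[OF m(1) that] matchedD(3)[OF m(2) that] matrix_vector_right_distrib)
  qed
  show "ip\<^sub>2 b (g + g') = ip\<^sub>1 a (f + f')" if ab: "matched a b" for a b
    using dom.ip_add_right[OF in1 matchedD(1)[OF ab]] cod.ip_add_right[OF in2 matchedD(2)[OF ab]]
      partner_adjoint[OF p(1) ab] partner_adjoint[OF p(2) ab] by (simp only:)
qed

lemma partner_scale:
  assumes p: "partner f g" shows "partner (c *\<^sub>C f) (c *\<^sub>C g)"
proof (rule partnerI)
  note m = partner_matched[OF p]
  show "matched (c *\<^sub>C f) (c *\<^sub>C g)"
  proof (rule matchedI[OF dom.carrier_scale[OF matchedD(1)[OF m]] cod.carrier_scale[OF matchedD(2)[OF m]]])
    show "(c *\<^sub>C g) z = G z *v (c *\<^sub>C f) z" if "z \<in> \<Lambda>" for z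
      by (simp add: scaleC_fun_def scaleC_vec_eq matrix_vector_mult_smult matchedD(3)[OF m that])
  qed
  show "ip\<^sub>2 b (c *\<^sub>C g) = ip\<^sub>1 a (c *\<^sub>C f)" if ab: "matched a b" for a b
    using dom.ip_scaleC_right[OF matchedD(1)[OF ab] matchedD(1)[OF m]]
      cod.ip_scaleC_right[OF matchedD(2)[OF ab] matchedD(2)[OF m]] partner_adjoint[OF p ab]
    by (simp only:)
qed

lemma partner_zero: "partner 0 0"
proof (rule partnerI)
  show "matched 0 0" by (rule matchedI[OF dom.carrier_zero cod.carrier_zero]) simp
  show "ip\<^sub>2 b 0 = ip\<^sub>1 a 0" if ab: "matched a b" for a b
    using dom.ip_zero_right[OF matchedD(1)[OF ab]] cod.ip_zero_right[OF matchedD(2)[OF ab]]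
    by (simp only:)
qed

lemma partner_diff:
  assumes "partner f g" "partner f' g'" shows "partner (f - f') (g - g')"
proof -
  have "partner (f + (-1) *\<^sub>C f') (g + (-1) *\<^sub>C g')"
    by (rule partner_add[OF assms(1) partner_scale[OF assms(2)]])
  then show ?thesis by (simp only: cvs.scale_minus_left scaleC_one add_uminus_conv_diff)
qed

lemma partner_ip: "partner f g \<Longrightarrow> partner f' g' \<Longrightarrow> ip\<^sub>2 g g' = ip\<^sub>1 f f'"
  unfolding partner_def by blast

lemma partner_hnorm: "partner f g \<Longrightarrow> hnorm ip\<^sub>2 g = hnorm ip\<^sub>1 f"
  using partner_ip[of f g f g] by (simp add: hnorm_def)

text \<open>
The factorization rewrites \<open>G(z) K\<^sub>1(z, w) \<xi>\<close> as \<open>K\<^sub>2(z, w) (G(w)\<^sup>*)\<^sup>-\<^sup>1 \<xi>\<close>, and the reproducing property gives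
the inner products.
\<close>

lemma partner_kernel_section:
  assumes w: "w \<in> \<Lambda>"
  shows "partner (dom.ksec w \<xi>) (cod.ksec w (cadj (matrix_inv (G w)) *v \<xi>))"
proof -
  have wD: "w \<in> D" using w \<Lambda> by blast
  let ?R = "matrix_inv (G w)"
  have GR: "cadj (G w) ** cadj ?R = mat 1"
    using matrix_inv_left[OF invG[OF w]] by (simp add: cadj_mat flip: cadj_mult)
  have "cod.ksec w (cadj ?R *v \<xi>) z = G z *v dom.ksec w \<xi> z" if z: "z \<in> \<Lambda>" for z
  proof -
    have zD: "z \<in> D" using z \<Lambda> by blast
    have "K\<^sub>2 z w ** cadj ?R = G z ** K\<^sub>1 z w ** (cadj (G w) ** cadj ?R)"
      by (simp only: KG[OF z w] matrix_mul_assoc)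
    then have "K\<^sub>2 z w ** cadj ?R = G z ** K\<^sub>1 z w" by (simp only: GR matrix_mul_rid)
    then show ?thesis using zD by (simp add: matrix_vector_mul_assoc)
  qed
  then have "matched (dom.ksec w \<xi>) (cod.ksec w (cadj ?R *v \<xi>))"
    using dom.ksec_in[OF wD] cod.ksec_in[OF wD] by (intro matchedI)
  moreover have "ip\<^sub>2 b (cod.ksec w (cadj ?R *v \<xi>)) = ip\<^sub>1 a (dom.ksec w \<xi>)" if ab: "matched a b" for a b
  proof -
    have "ip\<^sub>2 b (cod.ksec w (cadj ?R *v \<xi>)) = cvec_inner (?R *v b w) \<xi>"
      by (simp add: cod.reproducing[OF wD matchedD(2)[OF ab]] cvec_inner_mult_right)
    also have "?R *v b w = (?R ** G w) *v a w"
      by (simp add: matchedD(3)[OF ab w] matrix_vector_mul_assoc)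
    also have "\<dots> = a w" by (simp add: matrix_inv_left[OF invG[OF w]])
    also have "cvec_inner (a w) \<xi> = ip\<^sub>1 a (dom.ksec w \<xi>)"
      by (rule dom.reproducing[OF wD matchedD(1)[OF ab], symmetric])
    finally show ?thesis .
  qed
  ultimately show ?thesis by (rule partnerI)
qed

lemma tendsto_matrix_vector:
  fixes A :: "complex ^ 'n ^ 'm"
  assumes "\<And>i. (\<lambda>k. X k $ i) \<longlonglongrightarrow> x $ i"
  shows "(\<lambda>k. (A *v X k) $ i) \<longlonglongrightarrow> (A *v x) $ i"
  unfolding matrix_vector_mult_def by (auto intro!: tendsto_intros assms)

text \<open>
Kernel sections at points of \<open>\<Lambda>\<close> have partners, and so have their linear combinations. These are dense,
because a function orthogonal to all of them vanishes on \<open>\<Lambda>\<close>. Partners have equal norms, so the partners of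
an approximating sequence form a Cauchy sequence; its limit is a partner of \<open>f\<close> since norm convergence implies
pointwise convergence.
\<close>

proposition partner_exists:
  assumes f: "f \<in> H\<^sub>1" shows "\<exists>g. partner f g"
proof -
  let ?S = "\<Union>w\<in>\<Lambda>. range (dom.ksec w)"
  let ?V = "cvs.span ?S"
  have SH: "?S \<subseteq> H\<^sub>1" using \<Lambda> by auto
  have total: "g = 0" if g: "g \<in> H\<^sub>1" and orth: "\<And>v. v \<in> ?V \<Longrightarrow> ip\<^sub>1 g v = 0" for g
  proof (rule dom.elem_eqI[OF g dom.carrier_zero conn \<Lambda>])
    fix z assume z: "z \<in> \<Lambda>"
    then have zD: "z \<in> D" using \<Lambda> by blast
    have "g z $ i = 0" for i
    proof -
      have "dom.ksec z (axis i 1) \<in> ?V" using z by (intro cvs.span_base) blast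
      then show ?thesis using orth dom.coordinate[OF zD g] by simp
    qed
    then show "g z = 0 z" by (simp add: vec_eq_iff)
  qed
  have "\<exists>X. (\<forall>k. X k \<in> ?V) \<and> (\<lambda>k. hnorm ip\<^sub>1 (X k - f)) \<longlonglongrightarrow> 0"
    by (rule dom.orthogonally_total_imp_dense[OF cvs.subspace_span
          cvs.span_minimal[OF SH dom.subspace_carrier] total f])
  then obtain X where XV: "\<And>k. X k \<in> ?V" and Xlim: "(\<lambda>k. hnorm ip\<^sub>1 (X k - f)) \<longlonglongrightarrow> 0" by blast
  have "\<exists>y. partner v y" if "v \<in> ?V" for v
    using that
  proof (induction rule: cvs.span_induct_alt)
    case base
    then show ?case using partner_zero by blast
  next
    case (step c x y)
    then obtain w \<xi> where w: "w \<in> \<Lambda>" and x: "x = dom.ksec w \<xi>" by auto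
    obtain y' where "partner y y'" using step.IH by blast
    then show ?case
      unfolding x using partner_add[OF partner_scale[OF partner_kernel_section[OF w]]] by blast
  qed
  then have "\<forall>k. \<exists>y. partner (X k) y" using XV by blast
  then obtain Y where Y: "\<And>k. partner (X k) (Y k)" by (auto dest!: choice)
  have XH: "X k \<in> H\<^sub>1" and YH: "Y k \<in> H\<^sub>2" for k
    using matchedD(1,2)[OF partner_matched[OF Y[of k]]] .
  have "\<exists>N. \<forall>j\<ge>N. \<forall>k\<ge>N. hnorm ip\<^sub>2 (Y j - Y k) < e" if e: "e > 0" for e
  proof -
    obtain N where N: "\<And>k. k \<ge> N \<Longrightarrow> hnorm ip\<^sub>1 (X k - f) < e / 2"
      using order_tendstoD(2)[OF Xlim, of "e / 2"] e unfolding eventually_sequentially by auto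
    have "hnorm ip\<^sub>2 (Y j - Y k) < e" if jk: "j \<ge> N" "k \<ge> N" for j k
    proof -
      have "hnorm ip\<^sub>2 (Y j - Y k) = hnorm ip\<^sub>1 (X j - X k)"
        using partner_hnorm[OF partner_diff[OF Y Y]] .
      also have "\<dots> \<le> hnorm ip\<^sub>1 (X j - f) + hnorm ip\<^sub>1 (f - X k)"
        by (rule dom.hnorm_triangle_sub[OF XH f XH])
      also have "\<dots> < e"
        using N[OF jk(1)] N[OF jk(2)] dom.hnorm_minus_commute[OF f XH[of k]] by simp
      finally show ?thesis .
    qed
    then show ?thesis by blast
  qed
  then obtain g where g: "g \<in> H\<^sub>2" and Ylim: "(\<lambda>k. hnorm ip\<^sub>2 (Y k - g)) \<longlonglongrightarrow> 0"
    using cod.complete[of Y] YH by blast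
  have "matched f g"
  proof (rule matchedI[OF f g])
    fix z assume z: "z \<in> \<Lambda>"
    then have zD: "z \<in> D" using \<Lambda> by blast
    have "g z $ i = (G z *v f z) $ i" for i
    proof (rule LIMSEQ_unique)
      show "(\<lambda>k. Y k z $ i) \<longlonglongrightarrow> g z $ i" by (rule cod.tendsto_coordinate[OF YH g Ylim zD])
      have "Y k z = G z *v X k z" for k
        using matchedD(3)[OF partner_matched[OF Y] z] .
      then show "(\<lambda>k. Y k z $ i) \<longlonglongrightarrow> (G z *v f z) $ i"
        using tendsto_matrix_vector[OF dom.tendsto_coordinate[OF XH f Xlim zD]] by simp
    qed
    then show "g z = G z *v f z" by (simp add: vec_eq_iff)
  qed
  moreover have "ip\<^sub>2 b g = ip\<^sub>1 a f" if ab: "matched a b" for a b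
  proof (rule LIMSEQ_unique)
    note aH = matchedD(1)[OF ab] and bH = matchedD(2)[OF ab]
    show "(\<lambda>k. ip\<^sub>2 b (Y k)) \<longlonglongrightarrow> ip\<^sub>2 b g" by (rule cod.tendsto_ip_right[OF YH g bH Ylim])
    have "ip\<^sub>2 b (Y k) = ip\<^sub>1 a (X k)" for k
      using partner_adjoint[OF Y ab] .
    then show "(\<lambda>k. ip\<^sub>2 b (Y k)) \<longlonglongrightarrow> ip\<^sub>1 a f"
      using dom.tendsto_ip_right[OF XH f aH Xlim] by simp
  qed
  ultimately have "partner f g" by (rule partnerI)
  then show ?thesis by blast
qed

end

text \<open>
The situation is symmetric in the two spaces; this turns the existence of partners into surjectivity.
\<close>

lemma (in matched_rkhs) matched_rkhs_inverse:
  "matched_rkhs D H\<^sub>2 H\<^sub>1 ip\<^sub>2 ip\<^sub>1 K\<^sub>2 K\<^sub>1 \<Lambda> (\<lambda>z. matrix_inv (G z))"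
proof unfold_locales
  show "K\<^sub>1 z w = matrix_inv (G z) ** K\<^sub>2 z w ** cadj (matrix_inv (G w))"
    if z: "z \<in> \<Lambda>" and w: "w \<in> \<Lambda>" for z w
  proof -
    have "cadj (G w) ** cadj (matrix_inv (G w)) = mat 1"
      using matrix_inv_left[OF invG[OF w]] by (simp add: cadj_mat flip: cadj_mult)
    moreover have "matrix_inv (G z) ** K\<^sub>2 z w ** cadj (matrix_inv (G w)) =
        (matrix_inv (G z) ** G z) ** K\<^sub>1 z w ** (cadj (G w) ** cadj (matrix_inv (G w)))"
      by (simp only: KG[OF z w] matrix_mul_assoc)
    ultimately show ?thesis
      by (simp only: matrix_inv_left[OF invG[OF z]] matrix_mul_lid matrix_mul_rid)
  qed
qed (use conn \<Lambda> invG invertible_matrix_inv in auto)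

context matched_rkhs
begin

lemma matched_onto:
  assumes g: "g \<in> H\<^sub>2" shows "\<exists>f. matched f g"
proof -
  interpret inverse: matched_rkhs D H\<^sub>2 H\<^sub>1 ip\<^sub>2 ip\<^sub>1 K\<^sub>2 K\<^sub>1 \<Lambda> "\<lambda>z. matrix_inv (G z)"
    by (rule matched_rkhs_inverse)
  obtain f where "inverse.matched g f"
    using inverse.partner_exists[OF g] inverse.partner_matched by blast
  note f = inverse.matchedD[OF this]
  have "g z = G z *v f z" if "z \<in> \<Lambda>" for z
    by (simp add: f(3)[OF that] matrix_vector_mul_assoc matrix_inv_right[OF invG[OF that]])
  then show ?thesis using matchedI[OF f(2) g] by blast
qed

lemma matched_mult_z:
  assumes "matched f g" "mult_z f \<in> H\<^sub>1" "mult_z g \<in> H\<^sub>2" shows "matched (mult_z f) (mult_z g)"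
proof (rule matchedI[OF assms(2,3)])
  show "mult_z g z = G z *v mult_z f z" if "z \<in> \<Lambda>" for z
    by (simp add: mult_z_def scaleC_vec_eq matrix_vector_mult_smult matchedD(3)[OF assms(1) that])
qed

text \<open>
The unitary operator intertwines the two multiplications by \<open>z\<close>, as these act pointwise; passing to adjoints
inside the inner products gives the relation between \<open>T\<close> and \<open>S\<close>.
\<close>

proposition adjoints_unitarily_equivalent:
  assumes M1: "\<And>f. f \<in> H\<^sub>1 \<Longrightarrow> mult_z f \<in> H\<^sub>1" and M2: "\<And>g. g \<in> H\<^sub>2 \<Longrightarrow> mult_z g \<in> H\<^sub>2"
    and T: "is_adjoint H\<^sub>1 ip\<^sub>1 mult_z T" and S: "is_adjoint H\<^sub>2 ip\<^sub>2 mult_z S"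
  shows "unitarily_equivalent H\<^sub>1 ip\<^sub>1 T H\<^sub>2 ip\<^sub>2 S"
proof -
  define U where "U f = (SOME g. partner f g)" for f
  have U: "partner f (U f)" if "f \<in> H\<^sub>1" for f
    unfolding U_def using someI_ex[OF partner_exists[OF that]] .
  have UH: "U f \<in> H\<^sub>2" if "f \<in> H\<^sub>1" for f using matchedD(2)[OF partner_matched[OF U[OF that]]] .
  have U_eq: "U f = g" if "matched f g" for f g
    using matched_unique_right[OF partner_matched[OF U[OF matchedD(1)[OF that]]] that] .
  have Um: "matched f (U f)" if "f \<in> H\<^sub>1" for f using partner_matched[OF U[OF that]] .
  have "unitary_map H\<^sub>1 ip\<^sub>1 H\<^sub>2 ip\<^sub>2 U"
    unfolding unitary_map_def linear_map_on_def
  proof (intro conjI ballI allI)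
    show "U x \<in> H\<^sub>2" if "x \<in> H\<^sub>1" for x using UH[OF that] .
    show "U (x + y) = U x + U y" if "x \<in> H\<^sub>1" "y \<in> H\<^sub>1" for x y
      using U_eq[OF partner_matched[OF partner_add[OF U[OF that(1)] U[OF that(2)]]]] .
    show "U (a *\<^sub>C x) = a *\<^sub>C U x" if "x \<in> H\<^sub>1" for a x
      using U_eq[OF partner_matched[OF partner_scale[OF U[OF that]]]] .
    show "bij_betw U H\<^sub>1 H\<^sub>2"
      unfolding bij_betw_def
    proof
      show "inj_on U H\<^sub>1"
        by (rule inj_onI) (metis Um matched_unique_left)
      show "U ` H\<^sub>1 = H\<^sub>2"
      proof
        show "H\<^sub>2 \<subseteq> U ` H\<^sub>1"
        proof
          fix g assume "g \<in> H\<^sub>2"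
          then obtain f where f: "matched f g" using matched_onto by blast
          show "g \<in> U ` H\<^sub>1" using U_eq[OF f] matchedD(1)[OF f] by blast
        qed
      qed (use UH in blast)
    qed
    show "ip\<^sub>2 (U x) (U y) = ip\<^sub>1 x y" if "x \<in> H\<^sub>1" "y \<in> H\<^sub>1" for x y
      using partner_ip[OF U[OF that(1)] U[OF that(2)]] .
  qed
  moreover have "U (T f) = S (U f)" if f: "f \<in> H\<^sub>1" for f
  proof -
    have Tf: "T f \<in> H\<^sub>1" using T f unfolding is_adjoint_def by blast
    have SUf: "S (U f) \<in> H\<^sub>2" using S UH[OF f] unfolding is_adjoint_def by blast
    have eq: "ip\<^sub>2 y (U (T f)) = ip\<^sub>2 y (S (U f))" if y: "y \<in> H\<^sub>2" for y
    proof -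
      obtain h where hy: "matched h y" using matched_onto[OF y] by blast
      note h = matchedD(1)[OF hy]
      have "ip\<^sub>2 y (U (T f)) = ip\<^sub>1 h (T f)"
        by (rule partner_adjoint[OF U[OF Tf] hy])
      also have "\<dots> = ip\<^sub>1 (mult_z h) f" using T f h unfolding is_adjoint_def by simp
      also have "\<dots> = ip\<^sub>2 (mult_z y) (U f)"
        by (rule partner_adjoint[OF U[OF f] matched_mult_z[OF hy M1[OF h] M2[OF y]], symmetric])
      also have "\<dots> = ip\<^sub>2 y (S (U f))" using S UH[OF f] y unfolding is_adjoint_def by simp
      finally show ?thesis .
    qed
    let ?d = "U (T f) - S (U f)"
    have d: "?d \<in> H\<^sub>2" using UH[OF Tf] SUf by simp
    have "ip\<^sub>2 ?d ?d = 0" using eq[OF d] cod.ip_diff_right[OF UH[OF Tf] SUf d] by simp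
    then have "?d = 0" using cod.ip_definite[OF d] by blast
    then show ?thesis by simp
  qed
  ultimately show ?thesis unfolding unitarily_equivalent_def by blast
qed

end

section \<open>Cowen-Douglas models\<close>

lemma conj_set_image: "conj_set \<Omega> = cnj ` \<Omega>"
  unfolding conj_set_def by (auto simp: image_iff) (metis complex_cnj_cnj)

lemma open_conj_set: "open \<Omega> \<Longrightarrow> open (conj_set \<Omega>)"
  unfolding conj_set_image image_cnj_conv_vimage_cnj by (intro open_vimage) auto

lemma connected_conj_set: "connected \<Omega> \<Longrightarrow> connected (conj_set \<Omega>)"
  unfolding conj_set_image by (intro connected_continuous_image) (auto intro: continuous_intros)

locale model = rkhs "conj_set \<Omega>" H ip K
  for \<Omega> :: "complex set"
    and H :: "(complex \<Rightarrow> complex ^ 'n) set"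
    and ip :: "(complex \<Rightarrow> complex ^ 'n) \<Rightarrow> (complex \<Rightarrow> complex ^ 'n) \<Rightarrow> complex"
    and K :: "complex \<Rightarrow> complex \<Rightarrow> complex ^ 'n ^ 'n" +
  fixes T :: "(complex \<Rightarrow> complex ^ 'n) \<Rightarrow> complex \<Rightarrow> complex ^ 'n"
  assumes cowen_douglas_model: "cowen_douglas_model \<Omega> H ip K T"
begin

lemma eigenspace: "w \<in> conj_set \<Omega> \<Longrightarrow> op_ker H T (cnj w) = range (ksec w)"
  using cowen_douglas_model unfolding cowen_douglas_model_def by blast

lemma kernel_invertible:
  assumes w: "w \<in> conj_set \<Omega>" shows "invertible (K w w)"
proof (rule invertible_diagonal_of_dim[OF w])
  have "cnj w \<in> \<Omega>" using w by (simp add: conj_set_def)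
  then have "cvs.dim (op_ker H T (cnj w)) = CARD('n)"
    using cowen_douglas_model unfolding cowen_douglas_model_def cowen_douglas_def by blast
  then show "cvs.dim (range (ksec w)) = CARD('n)" by (simp only: eigenspace[OF w])
qed

lemma mult_z_in: "f \<in> H \<Longrightarrow> mult_z f \<in> H"
  using cowen_douglas_model
  unfolding cowen_douglas_model_def bounded_operator_def linear_map_on_def by blast

lemma adjoint: "is_adjoint H ip mult_z T"
  using cowen_douglas_model unfolding cowen_douglas_model_def by blast

end

lemma modelI:
  assumes "open \<Omega>" "cowen_douglas_model \<Omega> H ip K T" shows "model \<Omega> H ip K T"
  using assms open_conj_set unfolding model_def rkhs_def model_axioms_def cowen_douglas_model_def by blast

locale two_models = T: model \<Omega> H\<^sub>T ip\<^sub>T K\<^sub>T T + S: model \<Omega> H\<^sub>S ip\<^sub>S K\<^sub>S S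
  for \<Omega> :: "complex set"
    and H\<^sub>T H\<^sub>S :: "(complex \<Rightarrow> complex ^ 'n) set"
    and ip\<^sub>T ip\<^sub>S :: "(complex \<Rightarrow> complex ^ 'n) \<Rightarrow> (complex \<Rightarrow> complex ^ 'n) \<Rightarrow> complex"
    and K\<^sub>T K\<^sub>S :: "complex \<Rightarrow> complex \<Rightarrow> complex ^ 'n ^ 'n"
    and T S :: "(complex \<Rightarrow> complex ^ 'n) \<Rightarrow> complex \<Rightarrow> complex ^ 'n" +
  assumes connected: "connected \<Omega>"
begin

abbreviation D where "D \<equiv> conj_set \<Omega>"

text \<open>
An intertwiner maps the eigenspace of \<open>T\<close> at \<open>cnj w\<close> into that of \<open>S\<close>. The matrix \<open>A(w)\<close> expresses this map
in the frames given by the coordinate sections.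
\<close>

lemma unitarily_equivalent_imp_frame_change:
  assumes "unitarily_equivalent H\<^sub>T ip\<^sub>T T H\<^sub>S ip\<^sub>S S"
  shows "\<exists>A. \<forall>z\<in>D. \<forall>w\<in>D. K\<^sub>T z w = cadj (A z) ** K\<^sub>S z w ** A w"
proof -
  obtain U where U: "unitary_map H\<^sub>T ip\<^sub>T H\<^sub>S ip\<^sub>S U" and UT: "\<And>x. x \<in> H\<^sub>T \<Longrightarrow> U (T x) = S (U x)"
    using assms unfolding unitarily_equivalent_def by blast
  have UH: "U x \<in> H\<^sub>S" if "x \<in> H\<^sub>T" for x
    using U that unfolding unitary_map_def linear_map_on_def by blast
  have Us: "U (a *\<^sub>C x) = a *\<^sub>C U x" if "x \<in> H\<^sub>T" for a x
    using U that unfolding unitary_map_def linear_map_on_def by blast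
  have Uip: "ip\<^sub>S (U x) (U y) = ip\<^sub>T x y" if "x \<in> H\<^sub>T" "y \<in> H\<^sub>T" for x y
    using U that unfolding unitary_map_def by blast
  have "\<exists>\<eta>. U (T.ksec w (axis j 1)) = S.ksec w \<eta>" if w: "w \<in> D" for w j
  proof -
    let ?x = "T.ksec w (axis j 1)"
    have xH: "?x \<in> H\<^sub>T" using w by simp
    have "?x \<in> op_ker H\<^sub>T T (cnj w)" unfolding T.eigenspace[OF w] by blast
    then have "T ?x = cnj w *\<^sub>C ?x" unfolding op_ker_def mem_Collect_eq by (simp only: right_minus_eq)
    then have "S (U ?x) = cnj w *\<^sub>C U ?x" using UT[OF xH] Us[OF xH] by (simp only:)
    then have "U ?x \<in> op_ker H\<^sub>S S (cnj w)"
      unfolding op_ker_def mem_Collect_eq using UH[OF xH] by (simp only: right_minus_eq)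
    then show ?thesis unfolding S.eigenspace[OF w] by blast
  qed
  then have "\<forall>w j. \<exists>\<eta>. w \<in> D \<longrightarrow> U (T.ksec w (axis j 1)) = S.ksec w \<eta>" by blast
  then obtain \<eta> where \<eta>: "\<And>w j. w \<in> D \<Longrightarrow> U (T.ksec w (axis j 1)) = S.ksec w (\<eta> w j)"
    by metis
  define A where "A w = (\<chi> i j. \<eta> w j $ i)" for w
  have A: "A w *v axis j 1 = \<eta> w j" for w j by (simp add: vec_eq_iff A_def)
  have "K\<^sub>T z w = cadj (A z) ** K\<^sub>S z w ** A w" if z: "z \<in> D" and w: "w \<in> D" for z w
  proof -
    have "K\<^sub>T z w $ i $ j = (cadj (A z) ** K\<^sub>S z w ** A w) $ i $ j" for i j
    proof -
      have "K\<^sub>T z w $ i $ j = ip\<^sub>T (T.ksec w (axis j 1)) (T.ksec z (axis i 1))"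
        using z w by (simp add: T.ip_ksec)
      also have "\<dots> = ip\<^sub>S (S.ksec w (A w *v axis j 1)) (S.ksec z (A z *v axis i 1))"
        using Uip[OF T.ksec_in[OF w] T.ksec_in[OF z], of "axis j 1" "axis i 1"]
        by (simp only: \<eta>[OF z] \<eta>[OF w] A)
      also have "\<dots> = cvec_inner (K\<^sub>S z w *v (A w *v axis j 1)) (A z *v axis i 1)"
        by (rule S.ip_ksec[OF z w])
      also have "\<dots> = cvec_inner ((cadj (A z) ** K\<^sub>S z w ** A w) *v axis j 1) (axis i 1)"
        by (simp only: cvec_inner_mult_right matrix_vector_mul_assoc matrix_mul_assoc)
      finally show ?thesis by simp
    qed
    then show ?thesis by (simp add: vec_eq_iff)
  qed
  then show ?thesis by blast
qed

text \<open>
Nothing is known about how \<open>A(w)\<close> depends on \<open>w\<close>, but \<open>K\<^sub>T(z, w\<^sub>0) = A(z)\<^sup>* K\<^sub>S(z, w\<^sub>0) A(w\<^sub>0)\<close> with \<open>w\<^sub>0\<close> fixed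
gives the holomorphic expression for the inverse of \<open>A(z)\<^sup>*\<close> that serves as \<open>\<Psi>\<close>.
\<close>

proposition unitarily_equivalent_imp_holomorphic_frame:
  assumes ue: "unitarily_equivalent H\<^sub>T ip\<^sub>T T H\<^sub>S ip\<^sub>S S" and ne: "\<Omega> \<noteq> {}"
  shows "\<exists>\<Lambda> \<Psi>. open \<Lambda> \<and> \<Lambda> \<noteq> {} \<and> \<Lambda> \<subseteq> D \<and>
       mat_holomorphic_on \<Psi> \<Lambda> \<and> (\<forall>\<mu>\<in>\<Lambda>. invertible (\<Psi> \<mu>)) \<and>
       (\<forall>\<mu>\<in>\<Lambda>. mat_wirtinger_deriv
          (\<lambda>w. matrix_inv (K\<^sub>T w w) ** matrix_inv (\<Psi> w) ** K\<^sub>S w w) \<mu> = 0)"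
proof -
  obtain A where A: "\<And>z w. z \<in> D \<Longrightarrow> w \<in> D \<Longrightarrow> K\<^sub>T z w = cadj (A z) ** K\<^sub>S z w ** A w"
    using unitarily_equivalent_imp_frame_change[OF ue] by blast
  obtain w\<^sub>0 where w0: "w\<^sub>0 \<in> D" using ne by (auto simp: conj_set_image)
  have iA: "invertible (A w)" if w: "w \<in> D" for w
    using T.kernel_invertible[OF w] unfolding A[OF w w] by (rule invertible_factors(2))
  \<comment> \<open>The set where \<open>K\<^sub>T(z, w\<^sub>0)\<close> can be inverted; it contains \<open>w\<^sub>0\<close>, so it is not empty.\<close>
  define \<Lambda> where "\<Lambda> = D \<inter> (\<lambda>z. det (K\<^sub>T z w\<^sub>0)) -` (- {0})"
  have sub: "\<Lambda> \<subseteq> D" unfolding \<Lambda>_def by blast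
  have iT: "invertible (K\<^sub>T z w\<^sub>0)" if "z \<in> \<Lambda>" for z
    using that by (simp add: \<Lambda>_def invertible_det_nz)
  have \<Lambda>: "open \<Lambda>"
    unfolding \<Lambda>_def
  proof (rule continuous_open_preimage)
    show "continuous_on D (\<lambda>z. det (K\<^sub>T z w\<^sub>0))"
      by (rule holomorphic_on_imp_continuous_on[OF holomorphic_on_det[OF T.kernel_holomorphic[OF w0]]])
  qed (use T.open_domain in auto)
  have "w\<^sub>0 \<in> \<Lambda>" using w0 T.kernel_invertible[OF w0] by (simp add: \<Lambda>_def invertible_det_nz)
  define \<Psi> where "\<Psi> z = K\<^sub>S z w\<^sub>0 ** A w\<^sub>0 ** matrix_inv (K\<^sub>T z w\<^sub>0)" for z
  have hol: "mat_holomorphic_on \<Psi> \<Lambda>"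
    unfolding \<Psi>_def
    by (intro mat_holomorphic_on_mult mat_holomorphic_on_inv mat_holomorphic_on_const iT
        mat_holomorphic_on_subset[OF S.kernel_holomorphic[OF w0] sub]
        mat_holomorphic_on_subset[OF T.kernel_holomorphic[OF w0] sub])
  have A\<Psi>: "cadj (A z) ** \<Psi> z = mat 1" if z: "z \<in> \<Lambda>" for z
  proof -
    have "cadj (A z) ** \<Psi> z = cadj (A z) ** K\<^sub>S z w\<^sub>0 ** A w\<^sub>0 ** matrix_inv (K\<^sub>T z w\<^sub>0)"
      by (simp only: \<Psi>_def matrix_mul_assoc)
    also have "\<dots> = K\<^sub>T z w\<^sub>0 ** matrix_inv (K\<^sub>T z w\<^sub>0)"
      using A[OF _ w0, of z] z sub by auto
    finally show ?thesis by (simp only: matrix_inv_right[OF iT[OF z]])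
  qed
  then have \<Psi>A: "\<Psi> z ** cadj (A z) = mat 1" if "z \<in> \<Lambda>" for z
    using that matrix_left_right_inverse by blast
  have quotient: "matrix_inv (K\<^sub>T w w) ** matrix_inv (\<Psi> w) ** K\<^sub>S w w = cadj (\<Psi> w)"
    if w: "w \<in> \<Lambda>" for w
  proof -
    have wD: "w \<in> D" using w sub by blast
    show ?thesis
    proof (rule matrix_cancel_right[OF iA[OF wD]])
      have "matrix_inv (K\<^sub>T w w) ** matrix_inv (\<Psi> w) ** K\<^sub>S w w ** A w =
          matrix_inv (K\<^sub>T w w) ** (cadj (A w) ** K\<^sub>S w w ** A w)"
        by (simp only: matrix_inv_unique[OF \<Psi>A[OF w]] matrix_mul_assoc)
      also have "\<dots> = mat 1"
        by (simp only: A[OF wD wD, symmetric] matrix_inv_left[OF T.kernel_invertible[OF wD]])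
      also have "\<dots> = cadj (cadj (A w) ** \<Psi> w)" by (simp add: A\<Psi>[OF w] cadj_mat)
      finally show "matrix_inv (K\<^sub>T w w) ** matrix_inv (\<Psi> w) ** K\<^sub>S w w ** A w = cadj (\<Psi> w) ** A w"
        by (simp only: cadj_mult cadj_cadj)
    qed
  qed
  have "mat_wirtinger_deriv (\<lambda>w. matrix_inv (K\<^sub>T w w) ** matrix_inv (\<Psi> w) ** K\<^sub>S w w) \<mu> = 0"
    if \<mu>: "\<mu> \<in> \<Lambda>" for \<mu>
  proof -
    have "wirtinger_deriv (\<lambda>w. (matrix_inv (K\<^sub>T w w) ** matrix_inv (\<Psi> w) ** K\<^sub>S w w) $ i $ j) \<mu> = 0" for i j
    proof (rule wirtinger_deriv_antiholomorphic[OF _ \<Lambda> \<mu>])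
      show "(\<lambda>w. \<Psi> w $ j $ i) holomorphic_on \<Lambda>" using hol unfolding mat_holomorphic_on_def by blast
      show "(matrix_inv (K\<^sub>T w w) ** matrix_inv (\<Psi> w) ** K\<^sub>S w w) $ i $ j = cnj (\<Psi> w $ j $ i)"
        if "w \<in> \<Lambda>" for w
        using quotient[OF that] by simp
    qed
    then show ?thesis unfolding mat_wirtinger_deriv_def by (simp add: vec_eq_iff)
  qed
  moreover have "invertible (\<Psi> \<mu>)" if "\<mu> \<in> \<Lambda>" for \<mu> using invertibleI[OF \<Psi>A[OF that]] .
  ultimately show ?thesis using \<Lambda> \<open>w\<^sub>0 \<in> \<Lambda>\<close> sub hol by blast
qed

proposition holomorphic_frame_imp_unitarily_equivalent:
  assumes \<Lambda>: "open \<Lambda>" "\<Lambda> \<noteq> {}" "\<Lambda> \<subseteq> D"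
    and \<Psi>: "mat_holomorphic_on \<Psi> \<Lambda>" "\<And>\<mu>. \<mu> \<in> \<Lambda> \<Longrightarrow> invertible (\<Psi> \<mu>)"
    and wirt: "\<And>\<mu>. \<mu> \<in> \<Lambda> \<Longrightarrow> mat_wirtinger_deriv
          (\<lambda>w. matrix_inv (K\<^sub>T w w) ** matrix_inv (\<Psi> w) ** K\<^sub>S w w) \<mu> = 0"
  shows "unitarily_equivalent H\<^sub>T ip\<^sub>T T H\<^sub>S ip\<^sub>S S"
proof -
  \<comment> \<open>The disc on which a kernel is bounded cannot be chosen, so the second one is sought inside the first.\<close>
  obtain b q where q: "0 < q" "ball b q \<subseteq> \<Lambda>" and KT: "bounded_kernel_on (ball b q) K\<^sub>T"
    using T.kernel_bounded_on_ball[OF \<Lambda> T.kernel_invertible] by blast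
  have "\<exists>c r. 0 < r \<and> ball c r \<subseteq> ball b q \<and> bounded_kernel_on (ball c r) K\<^sub>S"
    by (rule S.kernel_bounded_on_ball) (use q \<Lambda>(3) S.kernel_invertible in auto)
  then obtain c r where r: "0 < r" "ball c r \<subseteq> ball b q" and KS: "bounded_kernel_on (ball c r) K\<^sub>S"
    by blast
  have sub: "ball c r \<subseteq> \<Lambda>" using r q by blast
  have "\<exists>s G. 0 < s \<and> s \<le> r \<and> (\<forall>z\<in>ball c s. invertible (G z)) \<and>
      (\<forall>z\<in>ball c s. \<forall>w\<in>ball c s. K\<^sub>S z w = G z ** K\<^sub>T z w ** cadj (G w))"
    using sub \<Psi>(2) wirt
    by (intro kernel_factorization[OF r(1) bounded_kernel_on_subset[OF KT r(2)] KS
          mat_holomorphic_on_subset[OF \<Psi>(1) sub]]) blast+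
  then obtain s G where s: "0 < s" "s \<le> r" and G: "\<And>z. z \<in> ball c s \<Longrightarrow> invertible (G z)"
    "\<And>z w. z \<in> ball c s \<Longrightarrow> w \<in> ball c s \<Longrightarrow> K\<^sub>S z w = G z ** K\<^sub>T z w ** cadj (G w)"
    by blast
  have sD: "ball c s \<subseteq> D" using subset_ball[OF s(2), of c] sub \<Lambda>(3) by blast
  interpret matched_rkhs D H\<^sub>T H\<^sub>S ip\<^sub>T ip\<^sub>S K\<^sub>T K\<^sub>S "ball c s" G
    by unfold_locales (use connected_conj_set[OF connected] s(1) sD G in auto)
  show ?thesis
    by (rule adjoints_unitarily_equivalent[OF T.mult_z_in S.mult_z_in T.adjoint S.adjoint])
qed

end

theorem theorem3p5:
  fixes \<Omega> :: "complex set"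
    and H\<^sub>T H\<^sub>S :: "(complex \<Rightarrow> complex ^ 'n) set"
    and ip\<^sub>T ip\<^sub>S :: "(complex \<Rightarrow> complex ^ 'n) \<Rightarrow> (complex \<Rightarrow> complex ^ 'n) \<Rightarrow> complex"
    and K\<^sub>T K\<^sub>S :: "complex \<Rightarrow> complex \<Rightarrow> complex ^ 'n ^ 'n"
    and T S :: "(complex \<Rightarrow> complex ^ 'n) \<Rightarrow> complex \<Rightarrow> complex ^ 'n"
  assumes "open \<Omega>" and "connected \<Omega>" and "\<Omega> \<noteq> {}"
    and "cowen_douglas_model \<Omega> H\<^sub>T ip\<^sub>T K\<^sub>T T"
    and "cowen_douglas_model \<Omega> H\<^sub>S ip\<^sub>S K\<^sub>S S"
  shows "unitarily_equivalent H\<^sub>T ip\<^sub>T T H\<^sub>S ip\<^sub>S S \<longleftrightarrow>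
    (\<exists>\<Lambda> \<Psi>. open \<Lambda> \<and> \<Lambda> \<noteq> {} \<and> \<Lambda> \<subseteq> conj_set \<Omega> \<and>
       mat_holomorphic_on \<Psi> \<Lambda> \<and> (\<forall>\<mu>\<in>\<Lambda>. invertible (\<Psi> \<mu>)) \<and>
       (\<forall>\<mu>\<in>\<Lambda>. mat_wirtinger_deriv
          (\<lambda>w. matrix_inv (K\<^sub>T w w) ** matrix_inv (\<Psi> w) ** K\<^sub>S w w) \<mu> = 0))"
proof -
  interpret two_models \<Omega> H\<^sub>T H\<^sub>S ip\<^sub>T ip\<^sub>S K\<^sub>T K\<^sub>S T S
    using assms by (intro two_models.intro modelI two_models_axioms.intro)
  show ?thesis
    using unitarily_equivalent_imp_holomorphic_frame[OF _ assms(3)]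
      holomorphic_frame_imp_unitarily_equivalent by blast
qed

end
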